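(* Let $M$ be a compact oriented manifold without boundary, $I\subset\mathbb{R}$ an open interval about $0$, and $f_t:M\to S^n$ ($t\in I$) a smooth deformation of an immersion $f_0$ through immersions, such that for each $t$ the normal bundle of $f_t$ is diffeomorphic to the normal bundle $TM^\perp$ of $f_0$. Then every compatible deformation $\gamma_t:UM^\perp\to\mathcal Q$ ($t\in I$) of the geodesic Gauss map $\gamma_0$ of $f_0$ is Hamiltonian: with $V_t=\partial\gamma_t/\partial t\in\Gamma(\gamma_t^{-1}T\mathcal Q)$, the $1$-form $\sigma_{V_t}=\lambda_{\mathcal Q}(V_t,d\gamma_t(\cdot))$ on $UM^\perp$ is exact for every $t\in I$.
   Context: $S^n\subset\mathbb{R}^{n+1}$ is the round unit sphere with metric $g$, $\pi:US^n\to S^n$ its unit tangent bundle, $\pi^\perp:UM^\perp\to M$ the unit normal bundle of $f_0$. The spherical Gauss map of an immersion $f$ sends each unit normal vector of $f$ to itself as an element of $US^n$. $\mathcal Q=US^n/S^1$ is the quotient by geodesic flow, the manifold of oriented geodesics of $S^n$ ($\cong\mathrm{Gr}(2,n+1)$, oriented $2$-planes in $\mathbb{R}^{n+1}$), with quotient map $\pi_{\mathcal Q}:US^n\to\mathcal Q$. With $\theta(Z)=g(d\pi(Z),v)$ for $Z\in T_vUS^n$ the canonical contact form on $US^n$, $\lambda_{\mathcal Q}$ is the symplectic form on $\mathcal Q$ with $\pi_{\mathcal Q}^*\lambda_{\mathcal Q}=-d\theta$. The geodesic Gauss map of an immersion is $\pi_{\mathcal Q}$ composed with its spherical Gauss map;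 it is a Lagrangian immersion. Compatible deformation: a smooth family $\mu_t:UM^\perp\to US^n$, $t\in I$, with $\mu_0$ the spherical Gauss map of $f_0$, $\pi\circ\mu_t=f_t\circ\pi^\perp$ for each $t$, and such that $\mu_t$ is the composite of a bundle isomorphism over the identity of $M$ from $UM^\perp$ to the unit normal bundle of $f_t$ with the spherical Gauss map of $f_t$; the corresponding compatible deformation of $\gamma_0$ is $\gamma_t=\pi_{\mathcal Q}\circ\mu_t$. (Such $\mu_t$ exist, but are in general not unique when $M$ has codimension at least two.) *)

theory Defs
  imports "HOL-Analysis.Analysis"
begin

section \<open>Smooth maps between normed spaces\<close>

text \<open>All domains below are finite-dimensional, so continuity of all iterated directional
  derivatives is the usual notion of \<open>C\<^sup>k\<close>. The set \<open>S\<close> is meant to be open.\<close>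

primrec Ck_on :: "nat \<Rightarrow> ('a::real_normed_vector \<Rightarrow> 'b::real_normed_vector) \<Rightarrow> 'a set \<Rightarrow> bool" where
  "Ck_on 0 f S \<longleftrightarrow> continuous_on S f"
| "Ck_on (Suc k) f S \<longleftrightarrow>
     f differentiable_on S \<and> (\<forall>v. Ck_on k (\<lambda>x. frechet_derivative f (at x) v) S)"

definition smooth_on :: "('a::real_normed_vector \<Rightarrow> 'b::real_normed_vector) \<Rightarrow> 'a set \<Rightarrow> bool" where
  "smooth_on f S \<longleftrightarrow> (\<forall>k. Ck_on k f S)"


section \<open>Manifolds\<close>

type_synonym ('a, 'b) atlas = "('a set \<times> ('a \<Rightarrow> 'b)) set"

text \<open>Charts take values in a finite-dimensional real normed space \<open>'b\<close>. The class
  \<open>euclidean_space\<close> is not used for \<open>'b\<close> because its types have positive dimension, which would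
  exclude manifolds of dimension 0. Images of charts are open in \<open>'b\<close>: there is no boundary.\<close>

definition smooth_manifold :: "'a topology \<Rightarrow> ('a, 'b::real_normed_vector) atlas \<Rightarrow> bool" where
  "smooth_manifold X A \<longleftrightarrow>
     (\<exists>B::'b set. finite B \<and> span B = UNIV) \<and>
     Hausdorff_space X \<and> second_countable X \<and> \<Union>(fst ` A) = topspace X \<and>
     (\<forall>(U, \<phi>)\<in>A. openin X U \<and> open (\<phi> ` U) \<and>
        homeomorphic_map (subtopology X U) (top_of_set (\<phi> ` U)) \<phi>) \<and>
     (\<forall>(U, \<phi>)\<in>A. \<forall>(V, \<psi>)\<in>A. smooth_on (\<psi> \<circ> inv_into U \<phi>) (\<phi> ` (U \<inter> V)))"

text \<open>The determinant of an endomorphism \<open>L\<close>, by the Leibniz formula in the basis \<open>B\<close>.\<close>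

definition basis_det :: "'b::real_vector set \<Rightarrow> ('b \<Rightarrow> 'b) \<Rightarrow> real" where
  "basis_det B L = (\<Sum>p | p permutes B. of_int (sign p) * (\<Prod>b\<in>B. representation B (L b) (p b)))"

definition oriented_atlas :: "('a, 'b::real_normed_vector) atlas \<Rightarrow> bool" where
  "oriented_atlas A \<longleftrightarrow>
     (\<exists>B. independent B \<and> span B = UNIV \<and>
       (\<forall>(U, \<phi>)\<in>A. \<forall>(V, \<psi>)\<in>A. \<forall>y\<in>\<phi> ` (U \<inter> V).
          basis_det B (frechet_derivative (\<psi> \<circ> inv_into U \<phi>) (at y)) > 0))"

definition vec_atlas :: "('b, 'b) atlas" where
  "vec_atlas = {(UNIV, id)}"

definition prod_atlas :: "('a, 'b) atlas \<Rightarrow> ('c, 'd) atlas \<Rightarrow> ('a \<times> 'c, 'b \<times> 'd) atlas" where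
  "prod_atlas A B = {(U \<times> V, map_prod \<phi> \<psi>) | U \<phi> V \<psi>. (U, \<phi>) \<in> A \<and> (V, \<psi>) \<in> B}"

text \<open>Smooth maps between subsets \<open>S\<close> and \<open>T\<close> of manifolds: near every point of \<open>S\<close>, the coordinate
  expression of \<open>F\<close> is the restriction of a smooth map \<open>G\<close> defined on an open set of the model space
  of the ambient manifold. For embedded submanifolds \<open>S\<close> and \<open>T\<close> (such as unit tangent bundles of
  spheres and unit normal bundles) these are the smooth maps of manifolds.\<close>

definition smooth_map ::
  "('a, 'b::real_normed_vector) atlas \<Rightarrow> 'a set \<Rightarrow> ('c, 'd::real_normed_vector) atlas \<Rightarrow> 'c set
    \<Rightarrow> ('a \<Rightarrow> 'c) \<Rightarrow> bool" where
  "smooth_map A S B T F \<longleftrightarrow> F ` S \<subseteq> T \<and>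
     (\<forall>p\<in>S. \<exists>(U, \<phi>)\<in>A. \<exists>(V, \<psi>)\<in>B. \<exists>W G.
        p \<in> U \<and> F p \<in> V \<and> open W \<and> \<phi> p \<in> W \<and> smooth_on G W \<and>
        (\<forall>q\<in>S \<inter> U. \<phi> q \<in> W \<longrightarrow> F q \<in> V \<and> \<psi> (F q) = G (\<phi> q)))"

definition diffeomorphic ::
  "('a, 'b::real_normed_vector) atlas \<Rightarrow> 'a set \<Rightarrow> ('c, 'd::real_normed_vector) atlas \<Rightarrow> 'c set
    \<Rightarrow> bool" where
  "diffeomorphic A S B T \<longleftrightarrow>
     (\<exists>F G. smooth_map A S B T F \<and> smooth_map B T A S G \<and>
       (\<forall>x\<in>S. G (F x) = x) \<and> (\<forall>y\<in>T. F (G y) = y))"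

definition smooth_functions :: "('a, 'b::real_normed_vector) atlas \<Rightarrow> 'a set \<Rightarrow> ('a \<Rightarrow> real) set" where
  "smooth_functions A S = {u. smooth_map A S vec_atlas UNIV u}"

text \<open>Tangent vectors are represented by the derivations they induce on the algebra \<open>C\<close> of smooth
  functions; the tangent space consists of the velocities of smooth curves.\<close>

type_synonym 'a tangent = "('a \<Rightarrow> real) \<Rightarrow> real"

definition velocity :: "('a \<Rightarrow> real) set \<Rightarrow> (real \<Rightarrow> 'a) \<Rightarrow> real \<Rightarrow> 'a tangent" where
  "velocity C c t = (\<lambda>u\<in>C. deriv (\<lambda>s. u (c s)) t)"

definition smooth_curve_at ::
  "('a, 'b::real_normed_vector) atlas \<Rightarrow> 'a set \<Rightarrow> 'a \<Rightarrow> (real \<Rightarrow> 'a) \<Rightarrow> bool" where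
  "smooth_curve_at A S p c \<longleftrightarrow> (\<exists>e>0. smooth_map vec_atlas {-e<..<e} A S c) \<and> c 0 = p"

definition tangent_space :: "('a, 'b::real_normed_vector) atlas \<Rightarrow> 'a set \<Rightarrow> 'a \<Rightarrow> 'a tangent set" where
  "tangent_space A S p = {velocity (smooth_functions A S) c 0 | c. smooth_curve_at A S p c}"

text \<open>The differential of a map \<open>F\<close>; \<open>C\<close> is the algebra of smooth functions of its codomain.\<close>

definition differential :: "('c \<Rightarrow> real) set \<Rightarrow> ('a \<Rightarrow> 'c) \<Rightarrow> 'a tangent \<Rightarrow> 'c tangent" where
  "differential C F Z = (\<lambda>u\<in>C. Z (u \<circ> F))"

text \<open>Exactness of a 1-form \<open>\<sigma>\<close>, using \<open>dh(Z) = Z(h)\<close>.\<close>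

definition exact_1form ::
  "('a, 'b::real_normed_vector) atlas \<Rightarrow> 'a set \<Rightarrow> ('a \<Rightarrow> 'a tangent \<Rightarrow> real) \<Rightarrow> bool" where
  "exact_1form A S \<sigma> \<longleftrightarrow>
     (\<exists>h\<in>smooth_functions A S. \<forall>p\<in>S. \<forall>Z\<in>tangent_space A S p. \<sigma> p Z = Z h)"


section \<open>The unit tangent bundle of the sphere and the manifold of oriented geodesics\<close>

text \<open>\<open>S\<^sup>n\<close> is \<open>sphere 0 1\<close> in a Euclidean space of dimension \<open>n + 1\<close>; the unit tangent vector \<open>v\<close>
  at \<open>x\<close> is the pair \<open>(x, v)\<close>.\<close>

definition unit_tangent_bundle :: "('e::euclidean_space \<times> 'e) set" where
  "unit_tangent_bundle = {(x, v). norm x = 1 \<and> norm v = 1 \<and> x \<bullet> v = 0}"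

text \<open>The formula for the canonical contact form, and its exterior derivative, make sense on the
  whole ambient space \<open>'e \<times> 'e\<close>; restriction to the unit tangent bundle commutes with the exterior
  derivative.\<close>

definition contact_form :: "'e::euclidean_space \<times> 'e \<Rightarrow> 'e \<times> 'e \<Rightarrow> real" where
  "contact_form z Z = fst Z \<bullet> snd z"

definition ext_deriv :: "('b::real_normed_vector \<Rightarrow> 'b \<Rightarrow> real) \<Rightarrow> 'b \<Rightarrow> 'b \<Rightarrow> 'b \<Rightarrow> real" where
  "ext_deriv \<alpha> z Z W =
     frechet_derivative (\<lambda>y. \<alpha> y W) (at z) Z - frechet_derivative (\<lambda>y. \<alpha> y Z) (at z) W"

definition geodesic_flow :: "real \<Rightarrow> 'e::euclidean_space \<times> 'e \<Rightarrow> 'e \<times> 'e" where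
  "geodesic_flow s z =
     (cos s *\<^sub>R fst z + sin s *\<^sub>R snd z, cos s *\<^sub>R snd z - sin s *\<^sub>R fst z)"

definition piQ :: "'e::euclidean_space \<times> 'e \<Rightarrow> ('e \<times> 'e) set" where
  "piQ z = range (\<lambda>s. geodesic_flow s z)"

text \<open>The smooth structure of the quotient \<open>\<Q> = piQ ` unit_tangent_bundle\<close>: a function on \<open>\<Q>\<close> is
  smooth iff its pullback along the submersion \<open>piQ\<close> is.\<close>

definition smooth_functions_Q :: "(('e::euclidean_space \<times> 'e) set \<Rightarrow> real) set" where
  "smooth_functions_Q = {u. u \<circ> piQ \<in> smooth_functions vec_atlas unit_tangent_bundle}"

text \<open>\<open>lambda_Q\<close> is determined by the pullback identity \<open>\<lambda>(d\<pi> Z, d\<pi> W) = - d\<theta>(Z, W)\<close>, where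
  \<open>Z = a'(0)\<close> and \<open>W = b'(0)\<close> range over the tangent vectors of the unit tangent bundle. The
  value does not depend on the lifts, as \<open>d\<theta>\<close> is invariant under the geodesic flow and vanishes on
  its generator, which spans the kernel of \<open>d\<pi>\<close>. Arguments not tangent to \<open>\<Q>\<close> at \<open>q\<close> give
  an unspecified value.\<close>

definition lambda_Q ::
  "('e::euclidean_space \<times> 'e) set \<Rightarrow> ('e \<times> 'e) set tangent \<Rightarrow> ('e \<times> 'e) set tangent \<Rightarrow> real" where
  "lambda_Q q V W = (THE r. \<exists>z\<in>unit_tangent_bundle. \<exists>a b.
     smooth_curve_at vec_atlas unit_tangent_bundle z a \<and>
     smooth_curve_at vec_atlas unit_tangent_bundle z b \<and>
     q = piQ z \<and>
     V = velocity smooth_functions_Q (piQ \<circ> a) 0 \<and>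
     W = velocity smooth_functions_Q (piQ \<circ> b) 0 \<and>
     r = - ext_deriv contact_form z (vector_derivative a (at 0)) (vector_derivative b (at 0)))"


section \<open>Immersions into the sphere and their Gauss maps\<close>

definition immersion ::
  "('a, 'b::real_normed_vector) atlas \<Rightarrow> 'a set \<Rightarrow> ('a \<Rightarrow> 'e::euclidean_space) \<Rightarrow> bool" where
  "immersion A M f \<longleftrightarrow> smooth_map A M vec_atlas (sphere 0 1) f \<and>
     (\<forall>(U, \<phi>)\<in>A. \<forall>y\<in>\<phi> ` U. inj (frechet_derivative (f \<circ> inv_into U \<phi>) (at y)))"

definition normal_space ::
  "('a, 'b::real_normed_vector) atlas \<Rightarrow> ('a \<Rightarrow> 'e::euclidean_space) \<Rightarrow> 'a \<Rightarrow> 'e set" where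
  "normal_space A f p = {\<nu>. \<nu> \<bullet> f p = 0 \<and>
     (\<forall>(U, \<phi>)\<in>A. p \<in> U \<longrightarrow>
        (\<forall>w. \<nu> \<bullet> frechet_derivative (f \<circ> inv_into U \<phi>) (at (\<phi> p)) w = 0))}"

definition normal_bundle ::
  "('a, 'b::real_normed_vector) atlas \<Rightarrow> 'a set \<Rightarrow> ('a \<Rightarrow> 'e::euclidean_space) \<Rightarrow> ('a \<times> 'e) set" where
  "normal_bundle A M f = (SIGMA p:M. normal_space A f p)"

definition unit_normal_bundle ::
  "('a, 'b::real_normed_vector) atlas \<Rightarrow> 'a set \<Rightarrow> ('a \<Rightarrow> 'e::euclidean_space) \<Rightarrow> ('a \<times> 'e) set" where
  "unit_normal_bundle A M f = {(p, \<nu>) \<in> normal_bundle A M f. norm \<nu> = 1}"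

definition spherical_gauss_map :: "('a \<Rightarrow> 'e::euclidean_space) \<Rightarrow> 'a \<times> 'e \<Rightarrow> 'e \<times> 'e" where
  "spherical_gauss_map f \<xi> = (f (fst \<xi>), snd \<xi>)"

text \<open>Isomorphisms, over the identity of the base, of bundles contained in the product of a manifold
  with a vector space.\<close>

definition bundle_isomorphism ::
  "('a, 'b::real_normed_vector) atlas \<Rightarrow> ('a \<times> 'e::euclidean_space) set \<Rightarrow> ('a \<times> 'e) set
    \<Rightarrow> ('a \<times> 'e \<Rightarrow> 'a \<times> 'e) \<Rightarrow> bool" where
  "bundle_isomorphism A E E' \<Phi> \<longleftrightarrow>
     smooth_map (prod_atlas A vec_atlas) E (prod_atlas A vec_atlas) E' \<Phi> \<and>
     (\<forall>\<xi>\<in>E. fst (\<Phi> \<xi>) = fst \<xi>) \<and>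
     (\<exists>\<Psi>. smooth_map (prod_atlas A vec_atlas) E' (prod_atlas A vec_atlas) E \<Psi> \<and>
       (\<forall>\<xi>\<in>E. \<Psi> (\<Phi> \<xi>) = \<xi>) \<and> (\<forall>\<eta>\<in>E'. \<Phi> (\<Psi> \<eta>) = \<eta>))"

definition compatible_deformation ::
  "('a, 'b::real_normed_vector) atlas \<Rightarrow> 'a set \<Rightarrow> real set \<Rightarrow> (real \<Rightarrow> 'a \<Rightarrow> 'e::euclidean_space)
    \<Rightarrow> (real \<Rightarrow> 'a \<times> 'e \<Rightarrow> 'e \<times> 'e) \<Rightarrow> bool" where
  "compatible_deformation A M I f \<mu> \<longleftrightarrow>
     smooth_map (prod_atlas vec_atlas (prod_atlas A vec_atlas)) (I \<times> unit_normal_bundle A M (f 0))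
       vec_atlas unit_tangent_bundle (\<lambda>(t, \<xi>). \<mu> t \<xi>) \<and>
     (\<forall>\<xi>\<in>unit_normal_bundle A M (f 0). \<mu> 0 \<xi> = spherical_gauss_map (f 0) \<xi>) \<and>
     (\<forall>t\<in>I. \<forall>\<xi>\<in>unit_normal_bundle A M (f 0). fst (\<mu> t \<xi>) = f t (fst \<xi>)) \<and>
     (\<forall>t\<in>I. \<exists>\<Phi>.
        bundle_isomorphism A (unit_normal_bundle A M (f 0)) (unit_normal_bundle A M (f t)) \<Phi> \<and>
        (\<forall>\<xi>\<in>unit_normal_bundle A M (f 0). \<mu> t \<xi> = spherical_gauss_map (f t) (\<Phi> \<xi>)))"

text \<open>The 1-form \<open>\<lambda>(\<partial>\<gamma>\<^sub>t/\<partial>t, d\<gamma>\<^sub>t(\<cdot>))\<close> of a family of maps \<open>\<gamma>\<^sub>t\<close> into \<open>\<Q>\<close>.\<close>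

definition deformation_1form ::
  "(real \<Rightarrow> 'c \<Rightarrow> ('e::euclidean_space \<times> 'e) set) \<Rightarrow> real \<Rightarrow> 'c \<Rightarrow> 'c tangent \<Rightarrow> real" where
  "deformation_1form \<gamma> t \<xi> Z =
     lambda_Q (\<gamma> t \<xi>) (velocity smooth_functions_Q (\<lambda>s. \<gamma> s \<xi>) t)
       (differential smooth_functions_Q (\<gamma> t) Z)"

end

theory Submission
  imports Defs
begin

text \<open>The contact form pulls back to zero under each \<open>\<mu>\<^sub>t\<close>: the first component of \<open>\<mu>\<^sub>t\<close> moves in
  directions tangent to \<open>f\<^sub>t\<close>, while the second component is normal to \<open>f\<^sub>t\<close>. So the claim is an
  instance of a general principle: a deformation through Legendrian maps into \<open>US\<^sup>n\<close> projects to a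
  Hamiltonian deformation in the space of geodesics. The Hamiltonian is
  \<open>h = \<theta>(\<partial>\<mu>\<^sub>t/\<partial>t)\<close>. In Cartan's terms,
  \<open>dh = \<mu>\<^sub>t\<^sup>*(d(\<iota>\<theta>)) = \<partial>/\<partial>t (\<mu>\<^sub>t\<^sup>*\<theta>) - \<mu>\<^sub>t\<^sup>*(\<iota> d\<theta>) = - \<mu>\<^sub>t\<^sup>*(\<iota> d\<theta>)\<close>, with \<open>\<iota>\<close> the contraction by
  \<open>\<partial>\<mu>\<^sub>t/\<partial>t\<close>, and the right-hand side is the pullback of \<open>\<lambda>\<close> contracted with \<open>\<partial>\<gamma>\<^sub>t/\<partial>t\<close>.

  Written out in a chart, with \<open>\<mu>\<^sub>t = (x, v)\<close> and \<open>s\<close> the parameter of a curve in the source, this is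
  the comparison of two product rules,
  \<open>\<partial>\<^sub>s (\<partial>\<^sub>t x \<bullet> v) = \<partial>\<^sub>s\<partial>\<^sub>t x \<bullet> v + \<partial>\<^sub>t x \<bullet> \<partial>\<^sub>s v\<close> and
  \<open>0 = \<partial>\<^sub>t (\<partial>\<^sub>s x \<bullet> v) = \<partial>\<^sub>t\<partial>\<^sub>s x \<bullet> v + \<partial>\<^sub>s x \<bullet> \<partial>\<^sub>t v\<close>. Their difference, by symmetry of second
  derivatives, is \<open>\<partial>\<^sub>t x \<bullet> \<partial>\<^sub>s v - \<partial>\<^sub>s x \<bullet> \<partial>\<^sub>t v = - d\<theta>(\<partial>\<^sub>t \<mu>, \<partial>\<^sub>s \<mu>)\<close>
  (\<open>contact_potential_derivative\<close>).

  Three supporting theories make this precise. A calculus of smooth maps, whose only delicate point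
  is the chain rule: smoothness means that all iterated directional derivatives are continuous, each in a
  fixed direction, so the moving directions in the chain rule are expanded in coordinates, which are
  bounded in a finite-dimensional normed space. Smooth maps in
  charts and their composition. And the fact that \<open>lambda_Q\<close> really satisfies the pullback
  identity (\<open>lambda_Q_velocities\<close>): its value, a priori depending on a point of the geodesic and on
  lifts of the tangent vectors, is a rotation-invariant expression in the velocity of the bivector
  \<open>x \<and> v\<close>, and the entries of this bivector are smooth functions on the space of geodesics.\<close>

section \<open>Finite-dimensional normed spaces\<close>

text \<open>The model space of a manifold is only a normed space with a finite spanning set, as it may have
  dimension 0.\<close>

definition finite_dimensional :: "'b::real_normed_vector itself \<Rightarrow> bool" where
  "finite_dimensional _ \<longleftrightarrow> (\<exists>B::'b set. finite B \<and> span B = UNIV)"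

lemma finite_dimensional_euclidean [simp]: "finite_dimensional TYPE('e::euclidean_space)"
  unfolding finite_dimensional_def using span_Basis finite_Basis by blast

lemma finite_dimensional_prod [simp]:
  assumes "finite_dimensional TYPE('b::real_normed_vector)"
    and "finite_dimensional TYPE('c::real_normed_vector)"
  shows "finite_dimensional TYPE('b \<times> 'c)"
proof -
  obtain B :: "'b set" and C :: "'c set"
    where B: "finite B" "span B = UNIV" and C: "finite C" "span C = UNIV"
    using assms unfolding finite_dimensional_def by blast
  let ?D = "(\<lambda>x. (x, 0)) ` B \<union> (\<lambda>y. (0, y)) ` C"
  have l: "linear (\<lambda>x::'b. (x, 0::'c))" "linear (\<lambda>y::'c. (0::'b, y))"
    by (auto intro!: linearI)
  have "(x, y) \<in> span ?D" for x y
  proof -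
    have "span ((\<lambda>x. (x, 0)) ` B) \<subseteq> span ?D" "span ((\<lambda>y. (0, y)) ` C) \<subseteq> span ?D"
      by (auto intro!: span_mono)
    then have "(\<lambda>x. (x, 0)) ` span B \<subseteq> span ?D" "(\<lambda>y. (0, y)) ` span C \<subseteq> span ?D"
      by (simp_all only: linear_span_image[OF l(1)] linear_span_image[OF l(2)])
    then have "(x, 0) \<in> span ?D" "(0, y) \<in> span ?D"
      using B C by auto
    then have "(x, 0) + (0, y) \<in> span ?D"
      by (rule span_add)
    then show ?thesis
      by simp
  qed
  then have "span ?D = UNIV"
    by auto
  then show ?thesis
    unfolding finite_dimensional_def using B C by (intro exI[of _ ?D]) auto
qed

text \<open>If a sequence in the span converges, its coordinates are Cauchy, hence converge to coordinates of
  the limit.\<close>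

lemma closed_span_if_bounded_coordinates:
  fixes B :: "'b::real_normed_vector set"
  assumes "finite B" and C: "\<And>c b. b \<in> B \<Longrightarrow> \<bar>c b\<bar> \<le> C * norm (\<Sum>b\<in>B. c b *\<^sub>R b)"
  shows "closed (span B)"
  unfolding closed_sequential_limits
proof (intro allI impI, elim conjE)
  fix x l assume x: "\<forall>n. x n \<in> span B" and l: "x \<longlonglongrightarrow> l"
  then obtain c where c: "\<And>n. x n = (\<Sum>b\<in>B. c n b *\<^sub>R b)"
    unfolding span_finite[OF assms(1)] by (auto simp: image_iff) metis
  have diff: "x m - x n = (\<Sum>b\<in>B. (c m b - c n b) *\<^sub>R b)" for m n
    by (simp add: c sum_subtractf scaleR_diff_left)
  have "convergent (\<lambda>n. c n b)" if b: "b \<in> B" for b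
  proof -
    have "Cauchy (\<lambda>n. c n b)"
    proof (rule CauchyI)
      fix e :: real assume "e > 0"
      define D where "D = \<bar>C\<bar> + 1"
      have D: "D > 0" by (simp add: D_def add_nonneg_pos)
      have "Cauchy x"
        using l by (intro LIMSEQ_imp_Cauchy)
      then obtain N where N: "\<And>m n. m \<ge> N \<Longrightarrow> n \<ge> N \<Longrightarrow> norm (x m - x n) < e / D"
        using \<open>e > 0\<close> D by (meson CauchyD divide_pos_pos)
      have "norm (c m b - c n b) < e" if "m \<ge> N" "n \<ge> N" for m n
      proof -
        have "norm (c m b - c n b) \<le> C * norm (x m - x n)"
          using C[OF b, of "\<lambda>b. c m b - c n b"] by (simp add: diff)
        also have "\<dots> \<le> D * norm (x m - x n)"
          by (intro mult_right_mono) (auto simp: D_def)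
        also have "\<dots> < D * (e / D)"
          using N[OF that] D by (intro mult_strict_left_mono)
        finally show ?thesis using D by simp
      qed
      then show "\<exists>N. \<forall>m\<ge>N. \<forall>n\<ge>N. norm (c m b - c n b) < e" by blast
    qed
    then show ?thesis by (rule real_Cauchy_convergent)
  qed
  then obtain k where k: "\<And>b. b \<in> B \<Longrightarrow> (\<lambda>n. c n b) \<longlonglongrightarrow> k b"
    unfolding convergent_def by metis
  have "x \<longlonglongrightarrow> (\<Sum>b\<in>B. k b *\<^sub>R b)"
    unfolding c by (intro tendsto_sum tendsto_scaleR k tendsto_const)
  then have "l = (\<Sum>b\<in>B. k b *\<^sub>R b)"
    using l LIMSEQ_unique by blast
  then show "l \<in> span B"
    by (simp add: span_base span_scale span_sum)
qed

text \<open>Induction on the set: the new vector \<open>a\<close> has positive distance \<open>d\<close> to the span of the others,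
  since that span is closed, and this bounds the coordinate of \<open>a\<close> by \<open>norm x / d\<close>.\<close>

lemma independent_coordinates_bounded:
  fixes B :: "'b::real_normed_vector set"
  assumes "finite B" "independent B"
  shows "\<exists>C. \<forall>c. \<forall>b\<in>B. \<bar>c b\<bar> \<le> C * norm (\<Sum>b\<in>B. c b *\<^sub>R b)"
  using assms
proof (induction B rule: finite_induct)
  case empty
  show ?case by simp
next
  case (insert a B)
  then have ind: "independent B" and a: "a \<notin> span B"
    by (auto simp: independent_insert)
  obtain C where C: "\<And>c b. b \<in> B \<Longrightarrow> \<bar>c b\<bar> \<le> C * norm (\<Sum>b\<in>B. c b *\<^sub>R b)"
    using insert.IH[OF ind] by blast
  have "closed (span B)"
    using C by (intro closed_span_if_bounded_coordinates insert.hyps)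
  then have "open (- span B)"
    by (simp add: open_Compl)
  with a obtain d where d: "d > 0" "ball a d \<subseteq> - span B"
    by (meson Compl_iff openE)
  have dist: "d \<le> norm (a - y)" if "y \<in> span B" for y
    using d that by (force simp: dist_norm)
  \<comment> \<open>The first summand bounds the coordinate of \<open>a\<close>, the second one all others, as \<open>norm y \<le> (1 + norm a / d) * norm x\<close> for the remainder \<open>y\<close> of \<open>x\<close>.\<close>
  define D where "D = (1 / d) + \<bar>C\<bar> * (1 + norm a / d)"
  have D: "1 / d \<le> D" "C * (1 + norm a / d) \<le> D"
    using d by (auto simp: D_def intro!: add_increasing mult_right_mono)
  show ?case
  proof (intro exI[of _ D] allI ballI)
    fix c b assume b: "b \<in> insert a B"
    define y where "y = (\<Sum>b\<in>B. c b *\<^sub>R b)"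
    have y: "y \<in> span B"
      unfolding y_def by (simp add: span_base span_scale span_sum)
    have tot: "(\<Sum>b\<in>insert a B. c b *\<^sub>R b) = c a *\<^sub>R a + y" (is "?s = _")
      using insert.hyps by (simp add: y_def)
    have ca: "\<bar>c a\<bar> * d \<le> norm (c a *\<^sub>R a + y)"
    proof (cases "c a = 0")
      case False
      have "d \<le> norm (a - (- (1 / c a)) *\<^sub>R y)"
        using y by (intro dist span_scale)
      then have "\<bar>c a\<bar> * d \<le> \<bar>c a\<bar> * norm (a - (- (1 / c a)) *\<^sub>R y)"
        by (intro mult_left_mono) auto
      also have "\<dots> = norm (c a *\<^sub>R (a - (- (1 / c a)) *\<^sub>R y))"
        by simp
      also have "c a *\<^sub>R (a - (- (1 / c a)) *\<^sub>R y) = c a *\<^sub>R a + y"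
        using False by (simp add: algebra_simps)
      finally show ?thesis .
    qed auto
    then have ca': "\<bar>c a\<bar> \<le> (1 / d) * norm ?s"
      unfolding tot using d by (simp add: field_simps)
    show "\<bar>c b\<bar> \<le> D * norm ?s"
    proof (cases "b = a")
      case True
      then show ?thesis
        using ca' mult_right_mono[OF D(1), of "norm ?s"] by simp
    next
      case False
      with b have "b \<in> B" by simp
      have "norm y \<le> norm ?s + \<bar>c a\<bar> * norm a"
        unfolding tot using norm_triangle_ineq4[of "c a *\<^sub>R a + y" "c a *\<^sub>R a"] by simp
      also have "\<dots> \<le> norm ?s + (1 / d) * norm ?s * norm a"
        using ca' by (intro add_left_mono mult_right_mono) auto
      finally have ny: "norm y \<le> (1 + norm a / d) * norm ?s"
        by (simp add: algebra_simps)
      have "\<bar>c b\<bar> \<le> C * norm y"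
        using C[OF \<open>b \<in> B\<close>] by (simp add: y_def)
      also have "\<dots> \<le> \<bar>C\<bar> * norm y"
        by (intro mult_right_mono) auto
      also have "\<dots> \<le> \<bar>C\<bar> * ((1 + norm a / d) * norm ?s)"
        using ny by (intro mult_left_mono) auto
      also have "\<dots> \<le> D * norm ?s"
        using d by (simp add: D_def algebra_simps)
      finally show ?thesis .
    qed
  qed
qed

lemma finite_dimensional_coordinates:
  assumes "finite_dimensional TYPE('b::real_normed_vector)"
  obtains B :: "'b::real_normed_vector set" and l :: "'b \<Rightarrow> 'b \<Rightarrow> real"
  where "finite B" "\<And>b. b \<in> B \<Longrightarrow> bounded_linear (l b)" "\<And>x. (\<Sum>b\<in>B. l b x *\<^sub>R b) = x"
proof -
  obtain B0 :: "'b set" where B0: "finite B0" "span B0 = UNIV"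
    using assms unfolding finite_dimensional_def by blast
  obtain B where B: "B \<subseteq> B0" "independent B" "B0 \<subseteq> span B"
    using maximal_independent_subset[of B0] by blast
  have fin: "finite B" using B B0 finite_subset by blast
  have sp: "span B = UNIV"
    using span_minimal[OF B(3) subspace_span] B0(2) by auto
  define l where "l b x = representation B x b" for b x
  have sum: "(\<Sum>b\<in>B. l b x *\<^sub>R b) = x" for x
    unfolding l_def using B sp fin by (intro sum_representation_eq) auto
  obtain C where C: "\<And>c b. b \<in> B \<Longrightarrow> \<bar>c b\<bar> \<le> C * norm (\<Sum>b\<in>B. c b *\<^sub>R b)"
    using independent_coordinates_bounded[OF fin B(2)] by blast
  have "bounded_linear (l b)" if "b \<in> B" for b
  proof (rule bounded_linear_intro)
    show "l b (x + y) = l b x + l b y" for x y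
      unfolding l_def using B sp by (simp add: representation_add)
    show "l b (r *\<^sub>R x) = r *\<^sub>R l b x" for r x
      unfolding l_def using B sp by (simp add: representation_scale)
    show "norm (l b x) \<le> norm x * C" for x
      using C[OF that, of "\<lambda>b. l b x"] by (simp add: sum mult.commute)
  qed
  with fin sum show ?thesis using that by blast
qed

section \<open>Calculus of smooth maps\<close>

lemma Ck_on_subset: "Ck_on k f S \<Longrightarrow> T \<subseteq> S \<Longrightarrow> Ck_on k f T"
  by (induction k arbitrary: f) (auto intro: continuous_on_subset differentiable_on_subset)

lemma Ck_on_SucD:
  assumes "Ck_on (Suc k) f S"
  shows "Ck_on k f S"
  using assms
proof (induction k arbitrary: f)
  case 0
  then show ?case by (simp add: differentiable_imp_continuous_on)
next
  case (Suc k)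
  have "Ck_on k (\<lambda>x. frechet_derivative f (at x) v) S" for v
    by (rule Suc.IH) (use Suc.prems in simp)
  then show ?case using Suc.prems by simp
qed

lemma Ck_on_imp_has_derivative:
  assumes "Ck_on (Suc k) f S" "open S" "x \<in> S"
  shows "(f has_derivative frechet_derivative f (at x)) (at x)"
  using assms by (auto simp: differentiable_on_eq_differentiable_at frechet_derivative_works)

text \<open>Openness of \<open>S\<close> is essential: the derivatives in \<open>Ck_on\<close> are taken at \<open>x\<close>, not within \<open>S\<close>, so they
  depend on the values of the function in a full neighbourhood.\<close>

lemma Ck_on_cong:
  assumes "open S" "\<And>x. x \<in> S \<Longrightarrow> f x = g x" "Ck_on k f S"
  shows "Ck_on k g S"
  using assms(2,3)
proof (induction k arbitrary: f g)
  case 0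
  then show ?case by (auto intro: continuous_on_eq)
next
  case (Suc k)
  have d: "(g has_derivative frechet_derivative f (at x)) (at x)" if "x \<in> S" for x
    using has_derivative_transform_within_open[OF Ck_on_imp_has_derivative[OF Suc.prems(2) \<open>open S\<close> that]
        \<open>open S\<close> that] Suc.prems(1) by auto
  then have "g differentiable_on S"
    using \<open>open S\<close> by (auto simp: differentiable_on_eq_differentiable_at differentiable_def)
  moreover have "frechet_derivative f (at x) v = frechet_derivative g (at x) v" if "x \<in> S" for x v
    using frechet_derivative_at[OF d[OF that]] by simp
  then have "Ck_on k (\<lambda>x. frechet_derivative g (at x) v) S" for v
    by (rule Suc.IH) (use Suc.prems(2) in auto)
  ultimately show ?case
    by simp
qed

lemma Ck_on_SucI:
  assumes "open S" and "\<And>x. x \<in> S \<Longrightarrow> (f has_derivative f' x) (at x)"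
    and "\<And>v. Ck_on k (\<lambda>x. f' x v) S"
  shows "Ck_on (Suc k) f S"
proof -
  have eq: "f' x v = frechet_derivative f (at x) v" if "x \<in> S" for x v
    using frechet_derivative_at[OF assms(2)[OF that]] by simp
  have "Ck_on k (\<lambda>x. frechet_derivative f (at x) v) S" for v
    by (rule Ck_on_cong[OF assms(1) _ assms(3)[of v]]) (rule eq)
  moreover have "f differentiable_on S"
    using assms(1,2) by (auto simp: differentiable_on_eq_differentiable_at differentiable_def)
  ultimately show ?thesis by simp
qed

lemma Ck_on_const: "Ck_on k (\<lambda>x. c) S"
  by (induction k arbitrary: c) auto

lemma Ck_on_bounded_linear:
  assumes "open S" "bounded_linear L"
  shows "Ck_on k L S"
proof (cases k)
  case 0
  then show ?thesis using assms by (simp add: linear_continuous_on)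
next
  case (Suc n)
  show ?thesis unfolding Suc
    by (rule Ck_on_SucI[OF assms(1) bounded_linear_imp_has_derivative[OF assms(2)] Ck_on_const])
qed

lemma Ck_on_add:
  assumes "open S" "Ck_on k f S" "Ck_on k g S"
  shows "Ck_on k (\<lambda>x. f x + g x) S"
  using assms(2,3)
proof (induction k arbitrary: f g)
  case 0
  then show ?case by (simp add: continuous_on_add)
next
  case (Suc k)
  note d = Suc.prems[THEN Ck_on_imp_has_derivative, OF \<open>open S\<close>]
  show ?case
    by (rule Ck_on_SucI[OF \<open>open S\<close> has_derivative_add[OF d] Suc.IH])
      (use Suc.prems in simp_all)
qed

lemma Ck_on_sum:
  assumes "open S" "\<And>i. i \<in> T \<Longrightarrow> Ck_on k (f i) S"
  shows "Ck_on k (\<lambda>x. \<Sum>i\<in>T. f i x) S"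
  using assms(2)
  by (induction T rule: infinite_finite_induct) (auto intro!: Ck_on_add Ck_on_const \<open>open S\<close>)

lemma Ck_on_bounded_linear_compose:
  assumes "open S" "bounded_linear L" "Ck_on k f S"
  shows "Ck_on k (\<lambda>x. L (f x)) S"
  using assms(3)
proof (induction k arbitrary: f)
  case 0
  then show ?case using assms by (auto intro: bounded_linear.continuous_on)
next
  case (Suc k)
  note d = Ck_on_imp_has_derivative[OF Suc.prems \<open>open S\<close>]
  show ?case
    by (rule Ck_on_SucI[OF \<open>open S\<close> bounded_linear.has_derivative[OF assms(2) d] Suc.IH])
      (use Suc.prems in simp_all)
qed

lemma Ck_on_bilinear:
  assumes "open S" "bounded_bilinear P" "Ck_on k f S" "Ck_on k g S"
  shows "Ck_on k (\<lambda>x. P (f x) (g x)) S"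
  using assms(3,4)
proof (induction k arbitrary: f g)
  case 0
  then show ?case using assms by (auto intro: bounded_bilinear.continuous_on)
next
  case (Suc k)
  note d = Suc.prems[THEN Ck_on_imp_has_derivative, OF \<open>open S\<close>]
  note k = Suc.prems[THEN Ck_on_SucD]
  show ?case
    by (rule Ck_on_SucI[OF \<open>open S\<close> bounded_bilinear.FDERIV[OF assms(2) d]
          Ck_on_add[OF \<open>open S\<close> Suc.IH Suc.IH]])
      (use Suc.prems k in auto)
qed

text \<open>Continuity of all directional derivatives says nothing immediate about
  \<open>x \<mapsto> Dg (f x) (w x)\<close> with a varying direction \<open>w x\<close>. Expanding \<open>w x = Df x v\<close> in coordinates
  reduces it to a finite sum of products of \<open>C\<^sup>k\<close> functions, each with a fixed direction.\<close>

lemma Ck_on_compose: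
  fixes f :: "'a::real_normed_vector \<Rightarrow> 'b::real_normed_vector"
    and g :: "'b \<Rightarrow> 'c::real_normed_vector"
  assumes fin: "finite_dimensional TYPE('b)" and "open S" "open T" "f ` S \<subseteq> T"
    and "Ck_on k g T" "Ck_on k f S"
  shows "Ck_on k (\<lambda>x. g (f x)) S"
  using assms(5,6)
proof (induction k arbitrary: g)
  case 0
  then show ?case using assms(4) by (auto intro: continuous_on_compose2)
next
  case (Suc k)
  obtain B :: "'b set" and l where B: "finite B"
    and l: "\<And>b. b \<in> B \<Longrightarrow> bounded_linear (l b)" "\<And>x. (\<Sum>b\<in>B. l b x *\<^sub>R b) = x"
    using finite_dimensional_coordinates[OF fin] by blast
  let ?f' = "\<lambda>x. frechet_derivative f (at x)" and ?g' = "\<lambda>y. frechet_derivative g (at y)"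
  have g': "(g has_derivative ?g' y) (at y)" if "y \<in> T" for y
    using Ck_on_imp_has_derivative[OF Suc.prems(1) \<open>open T\<close> that] .
  have f': "(f has_derivative ?f' x) (at x)" if "x \<in> S" for x
    using Ck_on_imp_has_derivative[OF Suc.prems(2) \<open>open S\<close> that] .
  have eq: "?g' (f x) v = (\<Sum>b\<in>B. l b v *\<^sub>R ?g' (f x) b)" if "x \<in> S" for x v
  proof -
    have lin: "linear (?g' (f x))"
      using g'[of "f x"] assms(4) that by (auto intro: has_derivative_linear)
    have "?g' (f x) (\<Sum>b\<in>B. l b v *\<^sub>R b) = (\<Sum>b\<in>B. l b v *\<^sub>R ?g' (f x) b)"
      using lin by (simp add: linear_sum linear_scale)
    then show ?thesis by (simp add: l(2))
  qed
  have chain: "((\<lambda>x. g (f x)) has_derivative (\<lambda>v. \<Sum>b\<in>B. l b (?f' x v) *\<^sub>R ?g' (f x) b)) (at x)"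
    if "x \<in> S" for x
  proof -
    have "((\<lambda>x. g (f x)) has_derivative (\<lambda>v. ?g' (f x) (?f' x v))) (at x)"
      using has_derivative_compose[OF f'[OF that] g'] assms(4) that by auto
    moreover have "(\<lambda>v. ?g' (f x) (?f' x v)) = (\<lambda>v. \<Sum>b\<in>B. l b (?f' x v) *\<^sub>R ?g' (f x) b)"
      by (rule ext) (rule eq[OF that])
    ultimately show ?thesis by simp
  qed
  show ?case
  proof (rule Ck_on_SucI[OF \<open>open S\<close> chain])
    fix v
    show "Ck_on k (\<lambda>x. \<Sum>b\<in>B. l b (?f' x v) *\<^sub>R ?g' (f x) b) S"
    proof (rule Ck_on_sum[OF \<open>open S\<close>])
      fix b assume b: "b \<in> B"
      have 1: "Ck_on k (\<lambda>x. l b (?f' x v)) S"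
        using Suc.prems(2) by (intro Ck_on_bounded_linear_compose[OF \<open>open S\<close> l(1)[OF b]]) simp
      have 2: "Ck_on k (\<lambda>x. ?g' (f x) b) S"
        by (rule Suc.IH) (use Suc.prems(1) Ck_on_SucD[OF Suc.prems(2)] in simp_all)
      show "Ck_on k (\<lambda>x. l b (?f' x v) *\<^sub>R ?g' (f x) b) S"
        by (rule Ck_on_bilinear[OF \<open>open S\<close> bounded_bilinear_scaleR 1 2])
    qed
  qed
qed

lemma Ck_on_Pair:
  assumes "open S" "Ck_on k f S" "Ck_on k g S"
  shows "Ck_on k (\<lambda>x. (f x, g x)) S"
proof -
  have l: "bounded_linear (\<lambda>x::'b. (x, 0::'c))" "bounded_linear (\<lambda>y::'c. (0::'b, y))"
    by (simp_all add: bounded_linear_Pair bounded_linear_ident bounded_linear_zero)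
  have "Ck_on k (\<lambda>x. (f x, 0) + (0, g x)) S"
    using Ck_on_bounded_linear_compose[OF assms(1) l(1) assms(2)]
      Ck_on_bounded_linear_compose[OF assms(1) l(2) assms(3)]
    by (rule Ck_on_add[OF assms(1)])
  then show ?thesis by simp
qed

lemma smooth_on_subset: "smooth_on f S \<Longrightarrow> T \<subseteq> S \<Longrightarrow> smooth_on f T"
  unfolding smooth_on_def using Ck_on_subset by blast

lemma smooth_on_cong:
  "open S \<Longrightarrow> (\<And>x. x \<in> S \<Longrightarrow> f x = g x) \<Longrightarrow> smooth_on f S \<Longrightarrow> smooth_on g S"
  unfolding smooth_on_def by (intro allI Ck_on_cong[of S f g]) blast+

lemma smooth_on_const: "smooth_on (\<lambda>x. c) S"
  by (simp add: smooth_on_def Ck_on_const)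

lemma smooth_on_bounded_linear: "open S \<Longrightarrow> bounded_linear L \<Longrightarrow> smooth_on L S"
  unfolding smooth_on_def by (rule allI, rule Ck_on_bounded_linear) blast+

lemma smooth_on_compose:
  fixes f :: "'a::real_normed_vector \<Rightarrow> 'b::real_normed_vector"
  assumes "finite_dimensional TYPE('b)" "open S" "open T" "f ` S \<subseteq> T"
    and "smooth_on g T" "smooth_on f S"
  shows "smooth_on (\<lambda>x. g (f x)) S"
  using Ck_on_compose[OF assms(1-4)] assms(5,6) unfolding smooth_on_def by blast

lemma smooth_on_bounded_linear_compose:
  "open S \<Longrightarrow> bounded_linear L \<Longrightarrow> smooth_on f S \<Longrightarrow> smooth_on (\<lambda>x. L (f x)) S"
  unfolding smooth_on_def by (rule allI, rule Ck_on_bounded_linear_compose) blast+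

lemma smooth_on_bilinear:
  "open S \<Longrightarrow> bounded_bilinear P \<Longrightarrow> smooth_on f S \<Longrightarrow> smooth_on g S
    \<Longrightarrow> smooth_on (\<lambda>x. P (f x) (g x)) S"
  unfolding smooth_on_def by (rule allI, rule Ck_on_bilinear) blast+

lemma smooth_on_Pair:
  "open S \<Longrightarrow> smooth_on f S \<Longrightarrow> smooth_on g S \<Longrightarrow> smooth_on (\<lambda>x. (f x, g x)) S"
  unfolding smooth_on_def by (rule allI, rule Ck_on_Pair) blast+

lemma smooth_on_add:
  "open S \<Longrightarrow> smooth_on f S \<Longrightarrow> smooth_on g S \<Longrightarrow> smooth_on (\<lambda>x. f x + g x) S"
  unfolding smooth_on_def by (rule allI, rule Ck_on_add) blast+

lemma smooth_on_has_derivative: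
  assumes "smooth_on f S" "open S" "x \<in> S"
  shows "(f has_derivative frechet_derivative f (at x)) (at x)"
  using assms Ck_on_imp_has_derivative[of 0] unfolding smooth_on_def by blast

lemma smooth_on_directional_derivative:
  assumes "smooth_on f S"
  shows "smooth_on (\<lambda>x. frechet_derivative f (at x) v) S"
  unfolding smooth_on_def
proof
  fix k
  have "Ck_on (Suc k) f S" using assms unfolding smooth_on_def by blast
  then show "Ck_on k (\<lambda>x. frechet_derivative f (at x) v) S" by simp
qed

lemma smooth_on_imp_continuous_on: "smooth_on f S \<Longrightarrow> continuous_on S f"
  using Ck_on.simps(1) unfolding smooth_on_def by blast

text \<open>The mean value theorem, applied first in the direction \<open>v\<close> to the increment of \<open>f\<close> along \<open>w\<close>, and
  then in the direction \<open>w\<close> to the derivative along \<open>v\<close>.\<close>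

lemma second_difference_quotient:
  fixes f :: "'a::real_normed_vector \<Rightarrow> real"
  assumes f: "\<And>a b. 0 \<le> a \<Longrightarrow> a \<le> h \<Longrightarrow> 0 \<le> b \<Longrightarrow> b \<le> h \<Longrightarrow> z + a *\<^sub>R v + b *\<^sub>R w \<in> S"
    and "open S" "Ck_on 2 f S" "h > 0"
  obtains a b where "0 < a" "a < h" "0 < b" "b < h"
    "f (z + h *\<^sub>R v + h *\<^sub>R w) - f (z + h *\<^sub>R v) - f (z + h *\<^sub>R w) + f z
      = h\<^sup>2 * frechet_derivative (\<lambda>y. frechet_derivative f (at y) v) (at (z + a *\<^sub>R v + b *\<^sub>R w)) w"
proof -
  define g where "g y = frechet_derivative f (at y) v" for y
  have f2: "Ck_on (Suc (Suc 0)) f S"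
    using assms(3) by (simp only: numeral_2_eq_2)
  then have f1: "Ck_on (Suc 0) f S"
    by (rule Ck_on_SucD)
  have g1: "Ck_on (Suc 0) g S"
    using f2 unfolding Ck_on.simps(2)[of "Suc 0"] g_def[abs_def] by blast
  note f' = Ck_on_imp_has_derivative[OF f1 \<open>open S\<close>]
  note g' = Ck_on_imp_has_derivative[OF g1 \<open>open S\<close>]
  have path: "((\<lambda>s. f (q + s *\<^sub>R v)) has_derivative (\<lambda>r. r * g (q + s *\<^sub>R v))) (at s)"
    if "q + s *\<^sub>R v \<in> S" for s q
  proof -
    have "((\<lambda>s. f (q + s *\<^sub>R v)) has_derivative
        (\<lambda>r. frechet_derivative f (at (q + s *\<^sub>R v)) (r *\<^sub>R v))) (at s)"
      by (rule has_derivative_compose[where f = "\<lambda>s. q + s *\<^sub>R v", OF _ f'[OF that]])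
        (auto intro!: derivative_eq_intros)
    moreover have "frechet_derivative f (at (q + s *\<^sub>R v)) (r *\<^sub>R v) = r * g (q + s *\<^sub>R v)" for r
      using has_derivative_linear[OF f'[OF that]] by (simp add: g_def linear_scale)
    ultimately show ?thesis by simp
  qed
  have pathg: "((\<lambda>s. g (q + s *\<^sub>R w)) has_derivative
      (\<lambda>r. r * frechet_derivative g (at (q + s *\<^sub>R w)) w)) (at s)"
    if "q + s *\<^sub>R w \<in> S" for s q
  proof -
    have "((\<lambda>s. g (q + s *\<^sub>R w)) has_derivative
        (\<lambda>r. frechet_derivative g (at (q + s *\<^sub>R w)) (r *\<^sub>R w))) (at s)"
      by (rule has_derivative_compose[where f = "\<lambda>s. q + s *\<^sub>R w", OF _ g'[OF that]])
        (auto intro!: derivative_eq_intros)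
    moreover have "frechet_derivative g (at (q + s *\<^sub>R w)) (r *\<^sub>R w)
        = r * frechet_derivative g (at (q + s *\<^sub>R w)) w" for r
      using has_derivative_linear[OF g'[OF that]] by (simp add: linear_scale)
    ultimately show ?thesis by simp
  qed
  have S0: "z + a *\<^sub>R v \<in> S" if "0 \<le> a" "a \<le> h" for a
    using f[of a 0] that by simp
  have Sh: "(z + h *\<^sub>R w) + a *\<^sub>R v \<in> S" if "0 \<le> a" "a \<le> h" for a
    using f[of a h] that \<open>h > 0\<close> by (simp add: algebra_simps)
  have d1: "((\<lambda>s. f ((z + h *\<^sub>R w) + s *\<^sub>R v) - f (z + s *\<^sub>R v)) has_derivative
      (\<lambda>r. r * g ((z + h *\<^sub>R w) + s *\<^sub>R v) - r * g (z + s *\<^sub>R v))) (at s within {0..h})"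
    if "0 \<le> s" "s \<le> h" for s
    by (rule has_derivative_at_withinI[OF
          has_derivative_diff[OF path[OF Sh[OF that]] path[OF S0[OF that]]]])
  obtain a where a: "0 < a" "a < h" and a_eq:
    "(f ((z + h *\<^sub>R w) + h *\<^sub>R v) - f (z + h *\<^sub>R v)) - (f ((z + h *\<^sub>R w) + 0 *\<^sub>R v) - f (z + 0 *\<^sub>R v))
      = (h - 0) * g ((z + h *\<^sub>R w) + a *\<^sub>R v) - (h - 0) * g (z + a *\<^sub>R v)"
    using mvt_simple[OF \<open>h > 0\<close> d1] by auto
  have d2: "((\<lambda>s. g ((z + a *\<^sub>R v) + s *\<^sub>R w)) has_derivative
      (\<lambda>r. r * frechet_derivative g (at ((z + a *\<^sub>R v) + s *\<^sub>R w)) w)) (at s within {0..h})"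
    if "0 \<le> s" "s \<le> h" for s
    using a that by (intro has_derivative_at_withinI[OF pathg] f) auto
  obtain b where b: "0 < b" "b < h" and b_eq:
    "g ((z + a *\<^sub>R v) + h *\<^sub>R w) - g ((z + a *\<^sub>R v) + 0 *\<^sub>R w)
      = (h - 0) * frechet_derivative g (at ((z + a *\<^sub>R v) + b *\<^sub>R w)) w"
    using mvt_simple[OF \<open>h > 0\<close> d2] by auto
  have "f (z + h *\<^sub>R v + h *\<^sub>R w) - f (z + h *\<^sub>R v) - f (z + h *\<^sub>R w) + f z
      = h * (g ((z + a *\<^sub>R v) + h *\<^sub>R w) - g (z + a *\<^sub>R v))"
    using a_eq by (simp add: algebra_simps)
  also have "\<dots> = h\<^sup>2 * frechet_derivative g (at (z + a *\<^sub>R v + b *\<^sub>R w)) w"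
    using b_eq by (simp add: power2_eq_square)
  finally show ?thesis
    using that a b by (simp add: g_def[abs_def])
qed

text \<open>The second difference is symmetric in \<open>v\<close> and \<open>w\<close>, and both iterated derivatives are its limit
  after division by \<open>h\<^sup>2\<close>. If they differed at \<open>z\<close>, a small \<open>h\<close> would contradict
  \<open>second_difference_quotient\<close>.\<close>

lemma second_derivative_symmetric_real:
  fixes f :: "'a::real_normed_vector \<Rightarrow> real"
  assumes "open S" "Ck_on 2 f S" "z \<in> S"
  shows "frechet_derivative (\<lambda>y. frechet_derivative f (at y) v) (at z) w
    = frechet_derivative (\<lambda>y. frechet_derivative f (at y) w) (at z) v" (is "?F z = ?G z")
proof (rule ccontr)
  assume neq: "?F z \<noteq> ?G z"
  define e where "e = \<bar>?F z - ?G z\<bar> / 2"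
  have "e > 0" using neq by (simp add: e_def)
  have "continuous_on S ?F" "continuous_on S ?G"
    using assms(2) by (auto simp: numeral_2_eq_2)
  then have "isCont ?F z" "isCont ?G z"
    using assms by (auto simp: continuous_on_eq_continuous_at)
  then have "(?F \<longlongrightarrow> ?F z) (nhds z)" "(?G \<longlongrightarrow> ?G z) (nhds z)"
    unfolding isCont_def
    using tendsto_at_iff_tendsto_nhds[of ?F z] tendsto_at_iff_tendsto_nhds[of ?G z] by blast+
  then have "\<forall>\<^sub>F y in nhds z. y \<in> S \<and> dist (?F y) (?F z) < e \<and> dist (?G y) (?G z) < e"
    using \<open>e > 0\<close> assms(1,3)
    by (intro eventually_conj tendstoD[where f = ?F] tendstoD[where f = ?G] eventually_nhds_in_open)
  then obtain d where d: "d > 0" and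
    near: "\<And>y. dist y z < d \<Longrightarrow> y \<in> S \<and> dist (?F y) (?F z) < e \<and> dist (?G y) (?G z) < e"
    unfolding eventually_nhds_metric by blast
  \<comment> \<open>Small enough for the parallelogram spanned by \<open>h *\<^sub>R v\<close> and \<open>h *\<^sub>R w\<close> at \<open>z\<close> to lie in the ball.\<close>
  define h where "h = d / (norm v + norm w + 1)"
  have h: "h > 0" "h * (norm v + norm w) < d"
    using d by (auto simp: h_def field_simps add_pos_nonneg intro!: divide_pos_pos)
  have close: "dist (z + a *\<^sub>R v + b *\<^sub>R w) z < d" if "0 \<le> a" "a \<le> h" "0 \<le> b" "b \<le> h" for a b
  proof -
    have "norm (a *\<^sub>R v + b *\<^sub>R w) \<le> a * norm v + b * norm w"
      using that by (intro order_trans[OF norm_triangle_ineq]) simp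
    also have "\<dots> \<le> h * (norm v + norm w)"
      using that by (simp add: distrib_left add_mono mult_right_mono)
    finally show ?thesis using h by (simp add: dist_norm add.assoc)
  qed
  have close': "dist (z + a *\<^sub>R w + b *\<^sub>R v) z < d" if "0 \<le> a" "a \<le> h" "0 \<le> b" "b \<le> h" for a b
    using close[of b a] that by (simp add: add_ac)
  obtain a b where ab: "0 < a" "a < h" "0 < b" "b < h" and F:
    "f (z + h *\<^sub>R v + h *\<^sub>R w) - f (z + h *\<^sub>R v) - f (z + h *\<^sub>R w) + f z
      = h\<^sup>2 * ?F (z + a *\<^sub>R v + b *\<^sub>R w)"
    using second_difference_quotient[of h z v w S f] near close assms h by blast
  obtain a' b' where ab': "0 < a'" "a' < h" "0 < b'" "b' < h" and G:
    "f (z + h *\<^sub>R w + h *\<^sub>R v) - f (z + h *\<^sub>R w) - f (z + h *\<^sub>R v) + f z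
      = h\<^sup>2 * ?G (z + a' *\<^sub>R w + b' *\<^sub>R v)"
    using second_difference_quotient[of h z w v S f] near close' assms h by blast
  have "h\<^sup>2 * ?F (z + a *\<^sub>R v + b *\<^sub>R w) = h\<^sup>2 * ?G (z + a' *\<^sub>R w + b' *\<^sub>R v)"
    using F G unfolding add.commute[of "h *\<^sub>R v"] add.assoc[of z] by linarith
  then have "?F (z + a *\<^sub>R v + b *\<^sub>R w) = ?G (z + a' *\<^sub>R w + b' *\<^sub>R v)"
    using h by simp
  moreover have "dist (?F (z + a *\<^sub>R v + b *\<^sub>R w)) (?F z) < e"
    "dist (?G (z + a' *\<^sub>R w + b' *\<^sub>R v)) (?G z) < e"
    using near close close' ab ab' by auto
  ultimately show False
    unfolding e_def dist_real_def by argo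
qed

lemma second_derivative_symmetric:
  fixes f :: "'a::real_normed_vector \<Rightarrow> 'e::euclidean_space"
  assumes "open S" "smooth_on f S" "z \<in> S"
  shows "frechet_derivative (\<lambda>y. frechet_derivative f (at y) v) (at z) w
    = frechet_derivative (\<lambda>y. frechet_derivative f (at y) w) (at z) v"
proof (rule euclidean_eqI)
  fix b :: 'e assume "b \<in> Basis"
  have bl: "bounded_linear (\<lambda>x. x \<bullet> b)"
    by (rule bounded_linear_inner_left)
  have comp: "frechet_derivative (\<lambda>y. g y \<bullet> b) (at y) u = frechet_derivative g (at y) u \<bullet> b"
    if "smooth_on g S" "y \<in> S" for g :: "'a \<Rightarrow> 'e" and y u
    using frechet_derivative_at[OF bounded_linear.has_derivative[OF bl
          smooth_on_has_derivative[OF that(1) \<open>open S\<close> that(2)]]] by metis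
  have comp2: "frechet_derivative (\<lambda>y. frechet_derivative (\<lambda>y. f y \<bullet> b) (at y) u) (at z) u'
      = frechet_derivative (\<lambda>y. frechet_derivative f (at y) u) (at z) u' \<bullet> b" for u u'
  proof -
    note s = smooth_on_directional_derivative[OF assms(2), of u]
    have "((\<lambda>y. frechet_derivative f (at y) u \<bullet> b) has_derivative
        (\<lambda>u'. frechet_derivative (\<lambda>y. frechet_derivative f (at y) u) (at z) u' \<bullet> b)) (at z)"
      by (rule bounded_linear.has_derivative[OF bl smooth_on_has_derivative[OF s assms(1,3)]])
    then have "((\<lambda>y. frechet_derivative (\<lambda>y. f y \<bullet> b) (at y) u) has_derivative
        (\<lambda>u'. frechet_derivative (\<lambda>y. frechet_derivative f (at y) u) (at z) u' \<bullet> b)) (at z)"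
      by (rule has_derivative_transform_within_open[OF _ assms(1,3)]) (simp add: comp[OF assms(2)])
    from frechet_derivative_at[OF this] show ?thesis by metis
  qed
  have "Ck_on 2 (\<lambda>y. f y \<bullet> b) S"
    using smooth_on_bounded_linear_compose[OF assms(1) bl assms(2)] unfolding smooth_on_def by blast
  from second_derivative_symmetric_real[OF assms(1) this assms(3), of v w]
  show "frechet_derivative (\<lambda>y. frechet_derivative f (at y) v) (at z) w \<bullet> b
    = frechet_derivative (\<lambda>y. frechet_derivative f (at y) w) (at z) v \<bullet> b"
    unfolding comp2 .
qed

section \<open>Smooth maps in charts\<close>

text \<open>The part of \<open>smooth_manifold\<close> that concerns charts alone; it is inherited by products.\<close>

definition smooth_atlas :: "('a, 'b::real_normed_vector) atlas \<Rightarrow> bool" where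
  "smooth_atlas A \<longleftrightarrow> finite_dimensional TYPE('b) \<and>
     (\<forall>(U, \<phi>)\<in>A. inj_on \<phi> U) \<and>
     (\<forall>(U, \<phi>)\<in>A. \<forall>(V, \<psi>)\<in>A.
        open (\<phi> ` (U \<inter> V)) \<and> smooth_on (\<psi> \<circ> inv_into U \<phi>) (\<phi> ` (U \<inter> V)))"

lemma smooth_atlasD:
  fixes A :: "('a, 'b::real_normed_vector) atlas"
  assumes "smooth_atlas A" "(U, \<phi>) \<in> A" "(V, \<psi>) \<in> A"
  shows "finite_dimensional TYPE('b)" "inj_on \<phi> U" "open (\<phi> ` (U \<inter> V))"
    and "smooth_on (\<psi> \<circ> inv_into U \<phi>) (\<phi> ` (U \<inter> V))"
  using assms unfolding smooth_atlas_def by fast+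

lemma smooth_manifold_imp_smooth_atlas:
  fixes A :: "('a, 'b::real_normed_vector) atlas"
  assumes "smooth_manifold X A"
  shows "smooth_atlas A"
proof -
  have hom: "openin X U \<and> open (\<phi> ` U) \<and>
      homeomorphic_map (subtopology X U) (top_of_set (\<phi> ` U)) \<phi>" if "(U, \<phi>) \<in> A" for U \<phi>
    using assms that unfolding smooth_manifold_def by blast
  have "inj_on \<phi> U" if "(U, \<phi>) \<in> A" for U \<phi>
  proof -
    have "topspace (subtopology X U) = U"
      using hom[OF that] openin_subset by fastforce
    then show ?thesis
      using hom[OF that] homeomorphic_imp_injective_map by fastforce
  qed
  moreover have "open (\<phi> ` (U \<inter> V))" if "(U, \<phi>) \<in> A" "(V, \<psi>) \<in> A" for U \<phi> V \<psi>
  proof -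
    have "openin (subtopology X U) (U \<inter> V)"
      using hom[OF that(2)] by (simp add: openin_subtopology_Int2)
    then have "openin (top_of_set (\<phi> ` U)) (\<phi> ` (U \<inter> V))"
      using hom[OF that(1)] homeomorphic_imp_open_map open_map_def by blast
    then show ?thesis
      using hom[OF that(1)] openin_open_eq by blast
  qed
  moreover have "finite_dimensional TYPE('b)"
    using assms unfolding smooth_manifold_def finite_dimensional_def by blast
  moreover have "\<forall>(U, \<phi>)\<in>A. \<forall>(V, \<psi>)\<in>A. smooth_on (\<psi> \<circ> inv_into U \<phi>) (\<phi> ` (U \<inter> V))"
    using assms unfolding smooth_manifold_def by blast
  ultimately show ?thesis
    unfolding smooth_atlas_def by blast
qed

lemma smooth_atlas_vec_atlas:
  assumes "finite_dimensional TYPE('b::real_normed_vector)"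
  shows "smooth_atlas (vec_atlas :: ('b, 'b) atlas)"
proof -
  have "id \<circ> inv_into UNIV id = (\<lambda>x::'b. x)"
    by (simp add: inv_id fun_eq_iff)
  moreover have "smooth_on (\<lambda>x::'b. x) UNIV"
    by (rule smooth_on_bounded_linear[OF open_UNIV bounded_linear_ident])
  ultimately show ?thesis
    using assms by (simp add: smooth_atlas_def vec_atlas_def)
qed

lemma inv_into_map_prod:
  assumes "inj_on \<phi> U" "inj_on \<psi> V" "x \<in> \<phi> ` U" "y \<in> \<psi> ` V"
  shows "inv_into (U \<times> V) (map_prod \<phi> \<psi>) (x, y) = (inv_into U \<phi> x, inv_into V \<psi> y)"
proof (rule inv_into_f_eq)
  show "inj_on (map_prod \<phi> \<psi>) (U \<times> V)"
    using assms by (simp add: map_prod_inj_on)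
  show "(inv_into U \<phi> x, inv_into V \<psi> y) \<in> U \<times> V"
    using assms by (auto intro: inv_into_into)
  show "map_prod \<phi> \<psi> (inv_into U \<phi> x, inv_into V \<psi> y) = (x, y)"
    using assms by (simp add: f_inv_into_f)
qed

lemma smooth_on_map_prod:
  fixes f :: "'a::real_normed_vector \<Rightarrow> 'b::real_normed_vector"
    and g :: "'c::real_normed_vector \<Rightarrow> 'd::real_normed_vector"
  assumes fin: "finite_dimensional TYPE('a)" "finite_dimensional TYPE('c)"
    and "open S" "open T" "smooth_on f S" "smooth_on g T"
  shows "smooth_on (map_prod f g) (S \<times> T)"
proof -
  have o: "open (S \<times> T)"
    using assms by (simp add: open_Times)
  have "smooth_on (\<lambda>z. f (fst z)) (S \<times> T)" "smooth_on (\<lambda>z. g (snd z)) (S \<times> T)"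
    by (rule smooth_on_compose[OF fin(1) o \<open>open S\<close>]; use assms o in
        \<open>auto intro: smooth_on_bounded_linear bounded_linear_fst\<close>)
      (rule smooth_on_compose[OF fin(2) o \<open>open T\<close>]; use assms o in
        \<open>auto intro: smooth_on_bounded_linear bounded_linear_snd\<close>)
  then have "smooth_on (\<lambda>z. (f (fst z), g (snd z))) (S \<times> T)"
    by (rule smooth_on_Pair[OF o])
  then show ?thesis
    by (simp add: map_prod_def case_prod_beta')
qed

lemma smooth_atlas_prod_atlas:
  fixes A :: "('a, 'b::real_normed_vector) atlas" and B :: "('c, 'd::real_normed_vector) atlas"
  assumes A: "smooth_atlas A" and B: "smooth_atlas B"
  shows "smooth_atlas (prod_atlas A B)"
proof -
  have fin: "finite_dimensional TYPE('b)" "finite_dimensional TYPE('d)"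
    using A B by (auto simp: smooth_atlas_def)
  have inj: "inj_on (map_prod \<phi> \<psi>) (U \<times> V)" if "(U, \<phi>) \<in> A" "(V, \<psi>) \<in> B" for U \<phi> V \<psi>
    using smooth_atlasD(2)[OF A that(1) that(1)] smooth_atlasD(2)[OF B that(2) that(2)]
    by (simp add: map_prod_inj_on)
  have trans: "open (map_prod \<phi> \<psi> ` ((U \<times> V) \<inter> (U' \<times> V'))) \<and>
      smooth_on (map_prod \<phi>' \<psi>' \<circ> inv_into (U \<times> V) (map_prod \<phi> \<psi>))
        (map_prod \<phi> \<psi> ` ((U \<times> V) \<inter> (U' \<times> V')))"
    if a: "(U, \<phi>) \<in> A" "(U', \<phi>') \<in> A" and b: "(V, \<psi>) \<in> B" "(V', \<psi>') \<in> B"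
    for U \<phi> U' \<phi>' V \<psi> V' \<psi>'
  proof -
    note a = smooth_atlasD[OF A a] and b = smooth_atlasD[OF B b]
    let ?S = "\<phi> ` (U \<inter> U')" and ?T = "\<psi> ` (V \<inter> V')"
    have im: "map_prod \<phi> \<psi> ` ((U \<times> V) \<inter> (U' \<times> V')) = ?S \<times> ?T"
      by (simp add: Times_Int_Times map_prod_image)
    have o: "open (?S \<times> ?T)"
      using a(3) b(3) by (rule open_Times)
    have "smooth_on (map_prod \<phi>' \<psi>' \<circ> inv_into (U \<times> V) (map_prod \<phi> \<psi>)) (?S \<times> ?T)"
    proof (rule smooth_on_cong[OF o _ smooth_on_map_prod[OF fin a(3) b(3) a(4) b(4)]])
      fix z assume "z \<in> ?S \<times> ?T"
      then obtain x y where "z = (x, y)" "x \<in> \<phi> ` U" "y \<in> \<psi> ` V"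
        by blast
      then show "map_prod (\<phi>' \<circ> inv_into U \<phi>) (\<psi>' \<circ> inv_into V \<psi>) z =
          (map_prod \<phi>' \<psi>' \<circ> inv_into (U \<times> V) (map_prod \<phi> \<psi>)) z"
        using inv_into_map_prod[OF a(2) b(2)] by simp
    qed
    with o show ?thesis
      by (simp only: im)
  qed
  show ?thesis
    unfolding smooth_atlas_def prod_atlas_def
    using fin inj trans by (simp add: finite_dimensional_prod) blast
qed

lemma smooth_mapE:
  assumes "smooth_map A S B T F" "p \<in> S"
  obtains U \<phi> V \<psi> W G where "(U, \<phi>) \<in> A" "(V, \<psi>) \<in> B" "p \<in> U" "F p \<in> V" "open W" "\<phi> p \<in> W"
    "smooth_on G W" "\<forall>q\<in>S \<inter> U. \<phi> q \<in> W \<longrightarrow> F q \<in> V \<and> \<psi> (F q) = G (\<phi> q)"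
proof -
  from assms obtain x y W G where "x \<in> A" "y \<in> B"
    and "p \<in> fst x \<and> F p \<in> fst y \<and> open W \<and> snd x p \<in> W \<and> smooth_on G W \<and>
      (\<forall>q\<in>S \<inter> fst x. snd x q \<in> W \<longrightarrow> F q \<in> fst y \<and> snd y (F q) = G (snd x q))"
    unfolding smooth_map_def case_prod_beta by metis
  then show ?thesis
    using that[of "fst x" "snd x" "fst y" "snd y" W G] by simp
qed

lemma smooth_mapI:
  assumes "\<And>p. p \<in> S \<Longrightarrow> F p \<in> T"
    and "\<And>p. p \<in> S \<Longrightarrow> \<exists>U \<phi> V \<psi> W G. (U, \<phi>) \<in> A \<and> (V, \<psi>) \<in> B \<and> p \<in> U \<and> F p \<in> V \<and> open W \<and>
      \<phi> p \<in> W \<and> smooth_on G W \<and> (\<forall>q\<in>S \<inter> U. \<phi> q \<in> W \<longrightarrow> F q \<in> V \<and> \<psi> (F q) = G (\<phi> q))"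
  shows "smooth_map A S B T F"
  unfolding smooth_map_def
proof (intro conjI ballI)
  show "F ` S \<subseteq> T"
    using assms(1) by blast
  fix p assume "p \<in> S"
  then obtain U \<phi> V \<psi> W G where "(U, \<phi>) \<in> A" "(V, \<psi>) \<in> B"
    and *: "p \<in> U \<and> F p \<in> V \<and> open W \<and> \<phi> p \<in> W \<and> smooth_on G W \<and>
      (\<forall>q\<in>S \<inter> U. \<phi> q \<in> W \<longrightarrow> F q \<in> V \<and> \<psi> (F q) = G (\<phi> q))"
    using assms(2) by metis
  then show "\<exists>(U, \<phi>)\<in>A. \<exists>(V, \<psi>)\<in>B. \<exists>W G. p \<in> U \<and> F p \<in> V \<and> open W \<and> \<phi> p \<in> W \<and> smooth_on G W \<and>
      (\<forall>q\<in>S \<inter> U. \<phi> q \<in> W \<longrightarrow> F q \<in> V \<and> \<psi> (F q) = G (\<phi> q))"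
    by (intro bexI[of _ "(U, \<phi>)"] bexI[of _ "(V, \<psi>)"] case_prodI exI[of _ W] exI[of _ G])
qed

lemma smooth_mapD: "smooth_map A S B T F \<Longrightarrow> p \<in> S \<Longrightarrow> F p \<in> T"
  unfolding smooth_map_def by blast

lemma open_preimage_if_smooth:
  assumes "smooth_on f S" "open S" "open T"
  shows "open {x \<in> S. f x \<in> T}"
proof -
  have "open (S \<inter> f -` T)"
    by (rule continuous_open_preimage[OF smooth_on_imp_continuous_on[OF assms(1)] assms(2,3)])
  moreover have "S \<inter> f -` T = {x \<in> S. f x \<in> T}"
    by auto
  ultimately show ?thesis
    by simp
qed

text \<open>Smoothness of a map is witnessed in some chart around each point. Composing with a chart transition
  gives a witness in any prescribed chart of the source.\<close>

lemma smooth_map_in_chart: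
  assumes A: "smooth_atlas A" and F: "smooth_map A S B T F"
    and p: "p \<in> S" "(U, \<phi>) \<in> A" "p \<in> U"
  obtains V \<psi> W G where "(V, \<psi>) \<in> B" "F p \<in> V" "open W" "\<phi> p \<in> W" "smooth_on G W"
    "\<forall>q\<in>S \<inter> U. \<phi> q \<in> W \<longrightarrow> F q \<in> V \<and> \<psi> (F q) = G (\<phi> q)"
proof -
  obtain U' \<phi>' V \<psi> W' G' where U': "(U', \<phi>') \<in> A" "p \<in> U'" and V: "(V, \<psi>) \<in> B" "F p \<in> V"
    and W': "open W'" "\<phi>' p \<in> W'" "smooth_on G' W'"
    and G': "\<forall>q\<in>S \<inter> U'. \<phi>' q \<in> W' \<longrightarrow> F q \<in> V \<and> \<psi> (F q) = G' (\<phi>' q)"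
    by (rule smooth_mapE[OF F p(1)]) (rule that)
  note tr = smooth_atlasD[OF A p(2) U'(1)]
  let ?\<tau> = "\<phi>' \<circ> inv_into U \<phi>"
  have \<tau>: "?\<tau> (\<phi> q) = \<phi>' q" if "q \<in> U" for q
    using tr(2) that by simp
  define W where "W = {y \<in> \<phi> ` (U \<inter> U'). ?\<tau> y \<in> W'}"
  have oW: "open W"
    unfolding W_def by (rule open_preimage_if_smooth[OF tr(4,3) W'(1)])
  have "smooth_on (\<lambda>y. G' (?\<tau> y)) W"
    by (rule smooth_on_compose[OF tr(1) oW W'(1) _ W'(3) smooth_on_subset[OF tr(4)]])
      (auto simp: W_def)
  moreover have "\<phi> p \<in> W"
    using \<tau>[OF p(3)] p U' W' by (auto simp: W_def)
  moreover have "F q \<in> V \<and> \<psi> (F q) = G' (?\<tau> (\<phi> q))" if "q \<in> S" "q \<in> U" "\<phi> q \<in> W" for q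
  proof -
    obtain q' where q': "q' \<in> U" "q' \<in> U'" "\<phi> q = \<phi> q'" and "?\<tau> (\<phi> q) \<in> W'"
      using \<open>\<phi> q \<in> W\<close> unfolding W_def by auto
    have "q = q'"
      using tr(2) q' that by (auto dest: inj_onD)
    then show ?thesis
      using G' that q' \<open>?\<tau> (\<phi> q) \<in> W'\<close> \<tau>[OF that(2)] by simp
  qed
  ultimately show ?thesis
    using that[OF V oW, of "\<lambda>y. G' (?\<tau> y)"] by simp
qed

lemma smooth_map_compose:
  assumes B: "smooth_atlas B" and F: "smooth_map A S B T F" and H: "smooth_map B T C R H"
  shows "smooth_map A S C R (H \<circ> F)"
proof (rule smooth_mapI)
  fix p assume p: "p \<in> S"
  note T = smooth_mapD[OF F]
  show "(H \<circ> F) p \<in> R"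
    using smooth_mapD[OF H T[OF p]] by simp
  obtain U \<phi> V \<psi> W G where U: "(U, \<phi>) \<in> A" "p \<in> U" and V: "(V, \<psi>) \<in> B" "F p \<in> V"
    and W: "open W" "\<phi> p \<in> W" "smooth_on G W"
    and G: "\<forall>q\<in>S \<inter> U. \<phi> q \<in> W \<longrightarrow> F q \<in> V \<and> \<psi> (F q) = G (\<phi> q)"
    by (rule smooth_mapE[OF F p]) (rule that)
  obtain V' \<psi>' W' G' where V': "(V', \<psi>') \<in> C" "H (F p) \<in> V'"
    and W': "open W'" "\<psi> (F p) \<in> W'" "smooth_on G' W'"
    and G': "\<forall>q\<in>T \<inter> V. \<psi> q \<in> W' \<longrightarrow> H q \<in> V' \<and> \<psi>' (H q) = G' (\<psi> q)"
    by (rule smooth_map_in_chart[OF B H T[OF p] V]) (rule that)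
  let ?W = "{y \<in> W. G y \<in> W'}"
  have oW: "open ?W"
    by (rule open_preimage_if_smooth[OF W(3,1) W'(1)])
  have "smooth_on (\<lambda>y. G' (G y)) ?W"
    by (rule smooth_on_compose[OF smooth_atlasD(1)[OF B V(1) V(1)] oW W'(1) _ W'(3)
          smooth_on_subset[OF W(3)]]) auto
  moreover have "\<phi> p \<in> ?W"
    using G p U W W' by simp
  moreover have "(H \<circ> F) q \<in> V' \<and> \<psi>' ((H \<circ> F) q) = G' (G (\<phi> q))"
    if "q \<in> S \<inter> U" "\<phi> q \<in> ?W" for q
    using G G' T[of q] that by simp
  ultimately show "\<exists>U \<phi> V \<psi> W G. (U, \<phi>) \<in> A \<and> (V, \<psi>) \<in> C \<and> p \<in> U \<and> (H \<circ> F) p \<in> V \<and> open W \<and>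
      \<phi> p \<in> W \<and> smooth_on G W \<and>
      (\<forall>q\<in>S \<inter> U. \<phi> q \<in> W \<longrightarrow> (H \<circ> F) q \<in> V \<and> \<psi> ((H \<circ> F) q) = G (\<phi> q))"
    using U V' oW
    by (intro exI[of _ U] exI[of _ \<phi>] exI[of _ V'] exI[of _ \<psi>'] exI[of _ ?W]
        exI[of _ "\<lambda>y. G' (G y)"]) auto
qed

lemma smooth_map_vecI:
  assumes "\<And>p. p \<in> S \<Longrightarrow> F p \<in> T"
    and "\<And>p. p \<in> S \<Longrightarrow> \<exists>U \<phi> W G. (U, \<phi>) \<in> A \<and> p \<in> U \<and> open W \<and> \<phi> p \<in> W \<and> smooth_on G W \<and>
      (\<forall>q\<in>S \<inter> U. \<phi> q \<in> W \<longrightarrow> F q = G (\<phi> q))"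
  shows "smooth_map A S vec_atlas T F"
proof (rule smooth_mapI)
  fix p assume p: "p \<in> S"
  then show "F p \<in> T" by (rule assms)
  show "\<exists>U \<phi> V \<psi> W G. (U, \<phi>) \<in> A \<and> (V, \<psi>) \<in> vec_atlas \<and> p \<in> U \<and> F p \<in> V \<and> open W \<and>
      \<phi> p \<in> W \<and> smooth_on G W \<and> (\<forall>q\<in>S \<inter> U. \<phi> q \<in> W \<longrightarrow> F q \<in> V \<and> \<psi> (F q) = G (\<phi> q))"
    using assms(2)[OF p] by (simp add: vec_atlas_def)
qed

lemma smooth_map_vec_in_chart:
  assumes A: "smooth_atlas A" and F: "smooth_map A S vec_atlas T F"
    and p: "p \<in> S" "(U, \<phi>) \<in> A" "p \<in> U"
  obtains W G where "open W" "\<phi> p \<in> W" "smooth_on G W"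
    "\<forall>q\<in>S \<inter> U. \<phi> q \<in> W \<longrightarrow> F q = G (\<phi> q)"
proof -
  obtain V \<psi> W G where "(V, \<psi>) \<in> vec_atlas" "F p \<in> V" "open W" "\<phi> p \<in> W" "smooth_on G W"
    and "\<forall>q\<in>S \<inter> U. \<phi> q \<in> W \<longrightarrow> F q \<in> V \<and> \<psi> (F q) = G (\<phi> q)"
    by (rule smooth_map_in_chart[OF A F p]) (rule that)
  then show ?thesis
    using that[of W G] by (simp add: vec_atlas_def)
qed

lemma smooth_curve_in_chart:
  assumes "smooth_curve_at B T p c"
  obtains V \<psi> W G where "(V, \<psi>) \<in> B" "p \<in> V" "open W" "0 \<in> W" "smooth_on G W"
    "\<forall>r\<in>W. c r \<in> T \<and> c r \<in> V \<and> \<psi> (c r) = G r"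
proof -
  obtain e where e: "e > 0" "smooth_map vec_atlas {-e<..<e} B T c" "c 0 = p"
    using assms unfolding smooth_curve_at_def by blast
  obtain U \<phi> V \<psi> W G where U: "(U, \<phi>) \<in> (vec_atlas :: (real, real) atlas)" "(0::real) \<in> U"
    and V: "(V, \<psi>) \<in> B" "c 0 \<in> V"
    and W: "open W" "\<phi> 0 \<in> W" "smooth_on G W"
    and G: "\<forall>q\<in>{-e<..<e} \<inter> U. \<phi> q \<in> W \<longrightarrow> c q \<in> V \<and> \<psi> (c q) = G (\<phi> q)"
    by (rule smooth_mapE[OF e(2), of 0]) (use e in simp, rule that)
  have id: "U = UNIV" "\<phi> = id"
    using U by (auto simp: vec_atlas_def)
  show ?thesis
  proof (rule that[of V \<psi> "W \<inter> {-e<..<e}" G])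
    show "smooth_on G (W \<inter> {-e<..<e})"
      using W(3) by (rule smooth_on_subset) auto
    show "\<forall>r\<in>W \<inter> {-e<..<e}. c r \<in> T \<and> c r \<in> V \<and> \<psi> (c r) = G r"
      using G smooth_mapD[OF e(2)] by (auto simp: id)
  qed (use V W e in \<open>auto simp: id open_Int\<close>)
qed

lemma smooth_curve_compose:
  assumes "smooth_atlas A" "smooth_curve_at A S p c" "smooth_map A S B T F"
  shows "smooth_curve_at B T (F p) (F \<circ> c)"
  using assms smooth_map_compose unfolding smooth_curve_at_def by fastforce

text \<open>In a vector space the chart is the identity, so near time 0 the curve itself is smooth in the sense
  of calculus.\<close>

lemma smooth_curve_vec:
  assumes "smooth_curve_at vec_atlas T p c"
  obtains W where "open W" "0 \<in> W" "smooth_on c W" "\<forall>r\<in>W. c r \<in> T"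
proof -
  obtain V \<psi> W G where V: "(V, \<psi>) \<in> vec_atlas" and W: "open W" "0 \<in> W" "smooth_on G W"
    and G: "\<forall>r\<in>W. c r \<in> T \<and> c r \<in> V \<and> \<psi> (c r) = G r"
    by (rule smooth_curve_in_chart[OF assms]) (rule that)
  then have "smooth_on c W"
    by (intro smooth_on_cong[OF W(1) _ W(3)]) (auto simp: vec_atlas_def)
  then show ?thesis using that[OF W(1,2)] G by blast
qed

lemma smooth_curve_has_vector_derivative:
  assumes "smooth_curve_at vec_atlas T p c"
  shows "(c has_vector_derivative vector_derivative c (at 0)) (at 0)"
proof -
  obtain W where W: "open W" "0 \<in> W" "smooth_on c W" and "\<forall>r\<in>W. c r \<in> T"
    by (rule smooth_curve_vec[OF assms]) (rule that)
  have "c differentiable (at 0)"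
    using smooth_on_has_derivative[OF W(3,1,2)] by (rule differentiableI)
  then show ?thesis
    by (simp add: vector_derivative_works)
qed

section \<open>The symplectic form on the manifold of oriented geodesics\<close>

text \<open>The bivector \<open>x \<and> v\<close> of an oriented geodesic, as a skew-symmetric endomorphism. Its matrix entries
  are the Pluecker coordinates of the oriented plane spanned by \<open>x\<close> and \<open>v\<close>.\<close>

definition bivector :: "'e::euclidean_space \<times> 'e \<Rightarrow> 'e \<Rightarrow> 'e" where
  "bivector z e = (fst z \<bullet> e) *\<^sub>R snd z - (snd z \<bullet> e) *\<^sub>R fst z"

definition bivector_deriv :: "'e::euclidean_space \<times> 'e \<Rightarrow> 'e \<times> 'e \<Rightarrow> 'e \<Rightarrow> 'e" where
  "bivector_deriv z Z e = (fst Z \<bullet> e) *\<^sub>R snd z + (fst z \<bullet> e) *\<^sub>R snd Z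
     - (snd Z \<bullet> e) *\<^sub>R fst z - (snd z \<bullet> e) *\<^sub>R fst Z"

lemma bivector_geodesic_flow: "bivector (geodesic_flow s z) = bivector z"
proof
  fix e
  have "(cos s)\<^sup>2 *\<^sub>R y + (sin s)\<^sup>2 *\<^sub>R y = y" for y :: 'a
    by (simp flip: scaleR_left_distrib)
  moreover have "bivector (geodesic_flow s z) e
      = ((cos s)\<^sup>2 *\<^sub>R bivector z e + (sin s)\<^sup>2 *\<^sub>R bivector z e)"
    by (simp add: bivector_def geodesic_flow_def inner_add_left inner_diff_left
        power2_eq_square algebra_simps)
  ultimately show "bivector (geodesic_flow s z) e = bivector z e"
    by simp
qed

lemma smooth_map_vec_vec:
  fixes F :: "'a::real_normed_vector \<Rightarrow> 'b::real_normed_vector"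
  assumes "smooth_on F UNIV"
  shows "smooth_map vec_atlas S vec_atlas UNIV F"
  by (rule smooth_map_vecI)
    (use assms in \<open>auto simp: vec_atlas_def intro!: exI[of _ UNIV] exI[of _ F]\<close>)

text \<open>The choice of a representative is harmless, as the bivector is constant along the geodesic flow.\<close>

definition bivector_entry_Q :: "'e::euclidean_space \<Rightarrow> 'e \<Rightarrow> ('e \<times> 'e) set \<Rightarrow> real" where
  "bivector_entry_Q e e' q = bivector (SOME z. z \<in> q) e \<bullet> e'"

lemma bivector_entry_Q_piQ: "bivector_entry_Q e e' (piQ z) = bivector z e \<bullet> e'"
proof -
  have "(SOME z'. z' \<in> piQ z) \<in> piQ z"
    by (rule someI[of _ "geodesic_flow 0 z"]) (simp add: piQ_def)
  then obtain s where "(SOME z'. z' \<in> piQ z) = geodesic_flow s z"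
    unfolding piQ_def by blast
  then show ?thesis
    by (simp add: bivector_entry_Q_def bivector_geodesic_flow)
qed

lemma bivector_entry_Q_smooth:
  "bivector_entry_Q e e' \<in> (smooth_functions_Q :: (('e::euclidean_space \<times> 'e) set \<Rightarrow> real) set)"
proof -
  have lin: "smooth_on (\<lambda>z::'e \<times> 'e. fst z \<bullet> d) UNIV" "smooth_on (\<lambda>z::'e \<times> 'e. snd z \<bullet> d) UNIV" for d
    by (auto intro!: smooth_on_bounded_linear
        bounded_linear_compose[OF bounded_linear_inner_left bounded_linear_fst, unfolded o_def]
        bounded_linear_compose[OF bounded_linear_inner_left bounded_linear_snd, unfolded o_def])
  note prod = smooth_on_bilinear[OF open_UNIV bounded_bilinear_mult]
  \<comment> \<open>A Pluecker coordinate is a quadratic polynomial.\<close>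
  have "smooth_on (\<lambda>z::'e \<times> 'e. (fst z \<bullet> e) * (snd z \<bullet> e') + (snd z \<bullet> e) * (fst z \<bullet> (- e'))) UNIV"
    by (rule smooth_on_add[OF open_UNIV prod[OF lin(1,2)] prod[OF lin(2,1)]])
  moreover have "(\<lambda>z::'e \<times> 'e. (fst z \<bullet> e) * (snd z \<bullet> e') + (snd z \<bullet> e) * (fst z \<bullet> (- e')))
      = bivector_entry_Q e e' \<circ> piQ"
    by (simp add: fun_eq_iff bivector_entry_Q_piQ bivector_def inner_diff_left)
  ultimately show ?thesis
    by (simp add: smooth_functions_Q_def smooth_functions_def smooth_map_vec_vec)
qed

lemma velocity_bivector_entry_Q:
  assumes "(a has_vector_derivative Z) (at 0)"
  shows "velocity smooth_functions_Q (piQ \<circ> a) 0 (bivector_entry_Q e e')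
    = bivector_deriv (a 0) Z e \<bullet> e'"
proof -
  have 1: "((\<lambda>s. fst (a s)) has_vector_derivative fst Z) (at 0)"
    "((\<lambda>s. snd (a s)) has_vector_derivative snd Z) (at 0)"
    using assms by (auto intro: bounded_linear.has_vector_derivative bounded_linear_fst bounded_linear_snd)
  have i: "((\<lambda>s. fst (a s) \<bullet> d) has_real_derivative fst Z \<bullet> d) (at 0)"
    "((\<lambda>s. snd (a s) \<bullet> d) has_real_derivative snd Z \<bullet> d) (at 0)" for d
    unfolding has_real_derivative_iff_has_vector_derivative
    by (rule bounded_linear.has_vector_derivative[OF bounded_linear_inner_left 1(1)],
        rule bounded_linear.has_vector_derivative[OF bounded_linear_inner_left 1(2)])
  have "((\<lambda>s. bivector (a s) e \<bullet> e') has_real_derivative bivector_deriv (a 0) Z e \<bullet> e') (at 0)"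
    unfolding bivector_def inner_diff_left inner_scaleR_left
    by (auto intro!: derivative_eq_intros i
        simp: bivector_deriv_def inner_diff_left inner_add_left algebra_simps)
  then show ?thesis
    by (simp add: velocity_def bivector_entry_Q_smooth bivector_entry_Q_piQ DERIV_imp_deriv)
qed

lemma unit_tangent_bundle_tangent:
  assumes a: "smooth_curve_at vec_atlas unit_tangent_bundle z a"
    and Z: "Z = vector_derivative a (at 0)"
  shows "fst Z \<bullet> fst z = 0" "snd Z \<bullet> snd z = 0" "fst Z \<bullet> snd z + snd Z \<bullet> fst z = 0"
proof -
  obtain W where W: "open W" "0 \<in> W" "smooth_on a W" and T: "\<forall>r\<in>W. a r \<in> unit_tangent_bundle"
    by (rule smooth_curve_vec[OF a]) (rule that)
  have z: "a 0 = z"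
    using a by (simp add: smooth_curve_at_def)
  have d: "(a has_vector_derivative Z) (at 0)"
    unfolding Z by (rule smooth_curve_has_vector_derivative[OF a])
  have 1: "((\<lambda>s. fst (a s)) has_vector_derivative fst Z) (at 0)"
    "((\<lambda>s. snd (a s)) has_vector_derivative snd Z) (at 0)"
    using d by (auto intro: bounded_linear.has_vector_derivative bounded_linear_fst bounded_linear_snd)
  have const: "D = 0" if "(k has_vector_derivative D) (at 0)" "\<And>r. r \<in> W \<Longrightarrow> k r = C"
    for k :: "real \<Rightarrow> real" and C D
  proof -
    have "((\<lambda>r. C) has_vector_derivative D) (at 0)"
      using that by (intro has_vector_derivative_transform_within_open[OF that(1) W(1,2)]) auto
    then show ?thesis
      using vector_derivative_unique_at has_vector_derivative_const by blast
  qed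
  note ip = bounded_bilinear.has_vector_derivative[OF bounded_bilinear_inner]
  have "fst (a 0) \<bullet> fst Z + fst Z \<bullet> fst (a 0) = 0"
    by (rule const[OF ip[OF 1(1) 1(1)], of 1])
      (use T in \<open>force simp: unit_tangent_bundle_def norm_eq_1\<close>)
  then show "fst Z \<bullet> fst z = 0"
    by (simp add: z inner_commute)
  have "snd (a 0) \<bullet> snd Z + snd Z \<bullet> snd (a 0) = 0"
    by (rule const[OF ip[OF 1(2) 1(2)], of 1])
      (use T in \<open>force simp: unit_tangent_bundle_def norm_eq_1\<close>)
  then show "snd Z \<bullet> snd z = 0"
    by (simp add: z inner_commute)
  have "fst (a 0) \<bullet> snd Z + fst Z \<bullet> snd (a 0) = 0"
    by (rule const[OF ip[OF 1(1) 1(2)], of 0])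
      (use T in \<open>force simp: unit_tangent_bundle_def\<close>)
  then show "fst Z \<bullet> snd z + snd Z \<bullet> fst z = 0"
    by (simp add: z inner_commute)
qed

lemma ext_deriv_contact_form:
  "- ext_deriv contact_form z Z W = fst Z \<bullet> snd W - fst W \<bullet> snd Z"
proof -
  have "((\<lambda>y::'a \<times> 'a. fst V \<bullet> snd y) has_derivative (\<lambda>y. fst V \<bullet> snd y)) (at z)" for V :: "'a \<times> 'a"
    by (rule bounded_linear_imp_has_derivative)
      (intro bounded_linear_compose[OF bounded_linear_inner_right bounded_linear_snd, unfolded o_def])
  from frechet_derivative_at[OF this, symmetric] show ?thesis
    by (simp add: ext_deriv_def contact_form_def)
qed

text \<open>At \<open>z = (x, v)\<close> and for a tangent vector \<open>Z\<close>, the endomorphism \<open>bivector_deriv z Z\<close> sends \<open>v\<close> to minus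
  the part of \<open>fst Z\<close> orthogonal to \<open>v\<close>, and \<open>x\<close> to the part of \<open>snd Z\<close> orthogonal to \<open>x\<close>; the
  components removed do not contribute to the inner products. The point of the formula is that its
  right-hand side depends on \<open>Z\<close> and \<open>W\<close> only through data visible on the space of geodesics, and
  on \<open>z\<close> only through an alternating pairing of \<open>x\<close> and \<open>v\<close>.\<close>

lemma contact_curvature_eq_bivector_deriv:
  assumes "z \<in> unit_tangent_bundle"
    and Z: "fst Z \<bullet> fst z = 0" "snd Z \<bullet> snd z = 0" "fst Z \<bullet> snd z + snd Z \<bullet> fst z = 0"
    and W: "fst W \<bullet> fst z = 0" "snd W \<bullet> snd z = 0" "fst W \<bullet> snd z + snd W \<bullet> fst z = 0"
  shows "- ext_deriv contact_form z Z W
    = bivector_deriv z W (snd z) \<bullet> bivector_deriv z Z (fst z)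
      - bivector_deriv z Z (snd z) \<bullet> bivector_deriv z W (fst z)"
proof -
  have z: "fst z \<bullet> fst z = 1" "snd z \<bullet> snd z = 1" "fst z \<bullet> snd z = 0" "snd z \<bullet> fst z = 0"
    using assms(1) by (auto simp: unit_tangent_bundle_def norm_eq_1 inner_commute)
  have v: "bivector_deriv z V (snd z) = (fst V \<bullet> snd z) *\<^sub>R snd z - fst V"
    and x: "bivector_deriv z V (fst z) = snd V - (snd V \<bullet> fst z) *\<^sub>R fst z"
    if "fst V \<bullet> fst z = 0" "snd V \<bullet> snd z = 0" for V
    using that z by (simp_all add: bivector_deriv_def)
  have "bivector_deriv z V (snd z) \<bullet> bivector_deriv z V' (fst z) = - (fst V \<bullet> snd V')"
    if "fst V \<bullet> fst z = 0" "snd V \<bullet> snd z = 0" "fst V' \<bullet> fst z = 0" "snd V' \<bullet> snd z = 0" for V V'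
    using that z by (simp add: v x inner_diff_left inner_diff_right inner_commute[of "snd z" "snd V'"])
  then show ?thesis
    using Z W by (simp add: ext_deriv_contact_form)
qed

lemma bivector_deriv_linear: "linear (bivector_deriv z Z)"
  by (rule linearI) (simp_all add: bivector_deriv_def algebra_simps)

text \<open>The pairing is alternating in \<open>(fst z, snd z)\<close>, and the geodesic flow acts on this pair by a
  rotation, which has determinant 1.\<close>

lemma skew_pairing_geodesic_flow:
  fixes L L' :: "'e::euclidean_space \<Rightarrow> 'e"
  assumes L: "linear L" and L': "linear L'"
  shows "L' (snd (geodesic_flow s z)) \<bullet> L (fst (geodesic_flow s z))
      - L (snd (geodesic_flow s z)) \<bullet> L' (fst (geodesic_flow s z))
    = L' (snd z) \<bullet> L (fst z) - L (snd z) \<bullet> L' (fst z)"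
proof -
  have rot: "L' (c *\<^sub>R snd z - d *\<^sub>R fst z) \<bullet> L (c *\<^sub>R fst z + d *\<^sub>R snd z)
      - L (c *\<^sub>R snd z - d *\<^sub>R fst z) \<bullet> L' (c *\<^sub>R fst z + d *\<^sub>R snd z)
    = (c\<^sup>2 + d\<^sup>2) * (L' (snd z) \<bullet> L (fst z) - L (snd z) \<bullet> L' (fst z))" for c d :: real
    by (simp add: linear_add[OF L] linear_add[OF L'] linear_diff[OF L]
        linear_diff[OF L'] linear_scale[OF L] linear_scale[OF L'] inner_add_left inner_add_right
        inner_diff_left inner_diff_right power2_eq_square inner_commute algebra_simps)
  show ?thesis
    using rot[of "cos s" "sin s"] by (simp add: geodesic_flow_def)
qed

text \<open>The pullback identity that characterizes the symplectic form, that is, independence of the lifts: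
  two lifts of the same geodesic differ by the geodesic flow, and lifts of the same
  tangent vector have the same bivector velocity. The contact curvature at both lifts is then the same
  alternating pairing.\<close>

lemma lambda_Q_velocities:
  assumes z: "z \<in> unit_tangent_bundle"
    and a: "smooth_curve_at vec_atlas unit_tangent_bundle z a"
    and b: "smooth_curve_at vec_atlas unit_tangent_bundle z b"
  shows "lambda_Q (piQ z) (velocity smooth_functions_Q (piQ \<circ> a) 0)
      (velocity smooth_functions_Q (piQ \<circ> b) 0)
    = - ext_deriv contact_form z (vector_derivative a (at 0)) (vector_derivative b (at 0))"
  unfolding lambda_Q_def
proof (rule the_equality)
  show "\<exists>z'\<in>unit_tangent_bundle. \<exists>a' b'.
     smooth_curve_at vec_atlas unit_tangent_bundle z' a' \<and>
     smooth_curve_at vec_atlas unit_tangent_bundle z' b' \<and>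
     piQ z = piQ z' \<and>
     velocity smooth_functions_Q (piQ \<circ> a) 0 = velocity smooth_functions_Q (piQ \<circ> a') 0 \<and>
     velocity smooth_functions_Q (piQ \<circ> b) 0 = velocity smooth_functions_Q (piQ \<circ> b') 0 \<and>
     - ext_deriv contact_form z (vector_derivative a (at 0)) (vector_derivative b (at 0))
      = - ext_deriv contact_form z' (vector_derivative a' (at 0)) (vector_derivative b' (at 0))"
    using assms by (intro bexI[of _ z] exI[of _ a] exI[of _ b]) simp_all
next
  fix r
  assume "\<exists>z'\<in>unit_tangent_bundle. \<exists>a' b'.
     smooth_curve_at vec_atlas unit_tangent_bundle z' a' \<and>
     smooth_curve_at vec_atlas unit_tangent_bundle z' b' \<and>
     piQ z = piQ z' \<and>
     velocity smooth_functions_Q (piQ \<circ> a) 0 = velocity smooth_functions_Q (piQ \<circ> a') 0 \<and>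
     velocity smooth_functions_Q (piQ \<circ> b) 0 = velocity smooth_functions_Q (piQ \<circ> b') 0 \<and>
     r = - ext_deriv contact_form z' (vector_derivative a' (at 0)) (vector_derivative b' (at 0))"
  then obtain z' a' b' where z': "z' \<in> unit_tangent_bundle" "piQ z = piQ z'"
    and a': "smooth_curve_at vec_atlas unit_tangent_bundle z' a'"
      "velocity smooth_functions_Q (piQ \<circ> a) 0 = velocity smooth_functions_Q (piQ \<circ> a') 0"
    and b': "smooth_curve_at vec_atlas unit_tangent_bundle z' b'"
      "velocity smooth_functions_Q (piQ \<circ> b) 0 = velocity smooth_functions_Q (piQ \<circ> b') 0"
    and r: "r = - ext_deriv contact_form z' (vector_derivative a' (at 0)) (vector_derivative b' (at 0))"
    by blast
  have "geodesic_flow 0 z' \<in> piQ z'"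
    unfolding piQ_def by blast
  then have "z' \<in> piQ z"
    using z'(2) by (simp add: geodesic_flow_def)
  then obtain s where s: "z' = geodesic_flow s z"
    unfolding piQ_def by blast
  have same: "bivector_deriv z (vector_derivative c (at 0)) = bivector_deriv z' (vector_derivative c' (at 0))"
    if c: "smooth_curve_at vec_atlas unit_tangent_bundle z c"
      and c': "smooth_curve_at vec_atlas unit_tangent_bundle z' c'"
      and eq: "velocity smooth_functions_Q (piQ \<circ> c) 0 = velocity smooth_functions_Q (piQ \<circ> c') 0"
    for c c'
  proof
    fix e
    have c0: "c 0 = z" "c' 0 = z'"
      using c c' by (auto simp: smooth_curve_at_def)
    have "bivector_deriv z (vector_derivative c (at 0)) e \<bullet> e'
        = bivector_deriv z' (vector_derivative c' (at 0)) e \<bullet> e'" for e'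
      using velocity_bivector_entry_Q[OF smooth_curve_has_vector_derivative[OF c], of e e']
        velocity_bivector_entry_Q[OF smooth_curve_has_vector_derivative[OF c'], of e e']
      by (simp add: eq c0)
    then show "bivector_deriv z (vector_derivative c (at 0)) e
        = bivector_deriv z' (vector_derivative c' (at 0)) e"
      by (rule euclidean_eqI)
  qed
  show "r = - ext_deriv contact_form z (vector_derivative a (at 0)) (vector_derivative b (at 0))"
    unfolding r
      contact_curvature_eq_bivector_deriv[OF z'(1) unit_tangent_bundle_tangent[OF a'(1) refl]
        unit_tangent_bundle_tangent[OF b'(1) refl]]
      contact_curvature_eq_bivector_deriv[OF z unit_tangent_bundle_tangent[OF a refl]
        unit_tangent_bundle_tangent[OF b refl]]
      same[OF a a', symmetric] same[OF b b', symmetric]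
    unfolding s by (rule skew_pairing_geodesic_flow[OF bivector_deriv_linear bivector_deriv_linear])
qed

section \<open>Deformations of Legendrian maps\<close>

text \<open>The heart of the matter, in a chart: \<open>G\<close> is the coordinate expression of the deformation, with time
  as first argument, and \<open>w\<close> is a direction in the source along which every map of the deformation is
  tangent to the contact distribution. Differentiating the potential \<open>\<theta>(\<partial>G/\<partial>t)\<close> along \<open>w\<close> and the
  vanishing function \<open>\<theta>(\<partial>G/\<partial>w)\<close> in time, the terms with a mixed second derivative cancel.\<close>

lemma contact_potential_derivative:
  fixes G :: "real \<times> 'b::real_normed_vector \<Rightarrow> 'e::euclidean_space \<times> 'e"
  assumes W: "open W" "(t, y) \<in> W" and G: "smooth_on G W"
    and legendrian: "\<And>s. (s, y) \<in> W \<Longrightarrow>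
      contact_form (G (s, y)) (frechet_derivative G (at (s, y)) (0, w)) = 0"
  shows "\<exists>D. ((\<lambda>x. contact_form (G (t, x)) (frechet_derivative G (at (t, x)) (1, 0)))
        has_derivative D) (at y) \<and>
      D w = - ext_deriv contact_form (G (t, y))
        (frechet_derivative G (at (t, y)) (1, 0)) (frechet_derivative G (at (t, y)) (0, w))"
proof -
  let ?z = "(t, y)" and ?G' = "\<lambda>z. frechet_derivative G (at z)"
  define G1 where "G1 z = ?G' z (1, 0)" for z
  define G2 where "G2 z = ?G' z (0, w)" for z
  define G1' where "G1' = frechet_derivative G1 (at ?z)"
  define G2' where "G2' = frechet_derivative G2 (at ?z)"
  have "smooth_on G1 W" "smooth_on G2 W"
    unfolding G1_def[abs_def] G2_def[abs_def] by (intro smooth_on_directional_derivative[OF G])+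
  then have d1: "(G1 has_derivative G1') (at ?z)" and d2: "(G2 has_derivative G2') (at ?z)"
    unfolding G1'_def G2'_def by (auto intro: smooth_on_has_derivative[OF _ W])
  have d: "(G has_derivative ?G' ?z) (at ?z)"
    by (rule smooth_on_has_derivative[OF G W])
  have symmetric: "G1' (0, w) = G2' (1, 0)"
    unfolding G1'_def G2'_def G1_def[abs_def] G2_def[abs_def]
    by (rule second_derivative_symmetric[OF W(1) G W(2)])
  have x: "((\<lambda>x. (t, x)) has_derivative (\<lambda>v. (0, v))) (at y)"
    by (auto intro!: derivative_eq_intros)
  have s: "((\<lambda>s. (s, y)) has_derivative (\<lambda>r. (r, 0))) (at t)"
    by (auto intro!: derivative_eq_intros)
  have hx: "((\<lambda>x. fst (G1 (t, x)) \<bullet> snd (G (t, x))) has_derivative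
      (\<lambda>v. fst (G1 ?z) \<bullet> snd (?G' ?z (0, v)) + fst (G1' (0, v)) \<bullet> snd (G ?z))) (at y)"
    by (intro has_derivative_inner has_derivative_fst has_derivative_snd
        has_derivative_compose[OF x d1] has_derivative_compose[OF x d])
  have hs: "((\<lambda>s. fst (G2 (s, y)) \<bullet> snd (G (s, y))) has_derivative
      (\<lambda>r. fst (G2 ?z) \<bullet> snd (?G' ?z (r, 0)) + fst (G2' (r, 0)) \<bullet> snd (G ?z))) (at t)"
    by (intro has_derivative_inner has_derivative_fst has_derivative_snd
        has_derivative_compose[OF s d2] has_derivative_compose[OF s d])
  have "open ((\<lambda>s. (s, y)) -` W)"
    by (rule open_vimage[OF W(1)]) (intro continuous_intros)
  then have "((\<lambda>s. 0) has_derivative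
      (\<lambda>r. fst (G2 ?z) \<bullet> snd (?G' ?z (r, 0)) + fst (G2' (r, 0)) \<bullet> snd (G ?z))) (at t)"
    by (rule has_derivative_transform_within_open[OF hs])
      (use W legendrian in \<open>auto simp: G2_def contact_form_def\<close>)
  then have "(\<lambda>r. fst (G2 ?z) \<bullet> snd (?G' ?z (r, 0)) + fst (G2' (r, 0)) \<bullet> snd (G ?z)) = (\<lambda>r. 0)"
    using has_derivative_unique has_derivative_const by blast
  then have "fst (G2 ?z) \<bullet> snd (G1 ?z) + fst (G2' (1, 0)) \<bullet> snd (G ?z) = 0"
    unfolding G1_def by meson
  then have "fst (G1 ?z) \<bullet> snd (?G' ?z (0, w)) + fst (G1' (0, w)) \<bullet> snd (G ?z)
      = - ext_deriv contact_form (G ?z) (G1 ?z) (G2 ?z)"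
    by (simp add: ext_deriv_contact_form symmetric G2_def)
  with hx show ?thesis
    unfolding contact_form_def G1_def G2_def by blast
qed

lemma chart_exists: "p \<in> \<Union>(fst ` A) \<Longrightarrow> \<exists>U \<phi>. (U, \<phi>) \<in> A \<and> p \<in> U"
  by auto

lemma smooth_map_Pair:
  fixes A :: "('a, 'b::real_normed_vector) atlas"
  assumes cover: "S \<subseteq> \<Union>(fst ` A)" and "t \<in> I"
  shows "smooth_map A S (prod_atlas vec_atlas A) (I \<times> S) (Pair (t::real))"
proof (rule smooth_mapI)
  fix p assume p: "p \<in> S"
  then show "(t, p) \<in> I \<times> S"
    using assms by simp
  obtain U \<phi> where U: "(U, \<phi>) \<in> A" "p \<in> U"
    using chart_exists[OF subsetD[OF cover p]] by blast
  have c: "(UNIV \<times> U, map_prod id \<phi>) \<in> prod_atlas vec_atlas A"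
    using U by (auto simp: prod_atlas_def vec_atlas_def)
  have "smooth_on (Pair t) (UNIV::'b set)"
    by (rule smooth_on_Pair[OF open_UNIV smooth_on_const
          smooth_on_bounded_linear[OF open_UNIV bounded_linear_ident]])
  then show "\<exists>U \<phi> V \<psi> W G. (U, \<phi>) \<in> A \<and> (V, \<psi>) \<in> prod_atlas vec_atlas A \<and> p \<in> U \<and> (t, p) \<in> V \<and>
      open W \<and> \<phi> p \<in> W \<and> smooth_on G W \<and>
      (\<forall>q\<in>S \<inter> U. \<phi> q \<in> W \<longrightarrow> (t, q) \<in> V \<and> \<psi> (t, q) = G (\<phi> q))"
    using U c
    by (intro exI[of _ U] exI[of _ \<phi>] exI[of _ "UNIV \<times> U"] exI[of _ "map_prod id \<phi>"]
        exI[of _ UNIV] exI[of _ "Pair t"]) simp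
qed

lemma smooth_curve_time:
  fixes A :: "('a, 'b::real_normed_vector) atlas"
  assumes cover: "S \<subseteq> \<Union>(fst ` A)" and "open I" "t \<in> I" "\<xi> \<in> S"
  shows "smooth_curve_at (prod_atlas vec_atlas A) (I \<times> S) (t, \<xi>) (\<lambda>s. (t + s, \<xi>))"
proof -
  obtain e where e: "e > 0" "ball t e \<subseteq> I"
    using assms by (meson openE)
  have "smooth_map vec_atlas {-e<..<e} (prod_atlas vec_atlas A) (I \<times> S) (\<lambda>s. (t + s, \<xi>))"
  proof (rule smooth_mapI)
    fix p assume "p \<in> {-e<..<e}"
    then show "(t + p, \<xi>) \<in> I \<times> S"
      using e assms by (auto simp: subset_iff dist_real_def)
    obtain U \<phi> where U: "(U, \<phi>) \<in> A" "\<xi> \<in> U"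
      using chart_exists[OF subsetD[OF cover \<open>\<xi> \<in> S\<close>]] by blast
    have c: "(UNIV \<times> U, map_prod id \<phi>) \<in> prod_atlas vec_atlas A"
      using U by (auto simp: prod_atlas_def vec_atlas_def)
    have "smooth_on (\<lambda>s. (t + s, \<phi> \<xi>)) UNIV"
      by (rule smooth_on_Pair[OF open_UNIV smooth_on_add[OF open_UNIV smooth_on_const
            smooth_on_bounded_linear[OF open_UNIV bounded_linear_ident]] smooth_on_const])
    then show "\<exists>U \<phi> V \<psi> W G. (U, \<phi>) \<in> vec_atlas \<and> (V, \<psi>) \<in> prod_atlas vec_atlas A \<and> p \<in> U \<and>
        (t + p, \<xi>) \<in> V \<and> open W \<and> \<phi> p \<in> W \<and> smooth_on G W \<and>
        (\<forall>q\<in>{-e<..<e} \<inter> U. \<phi> q \<in> W \<longrightarrow> (t + q, \<xi>) \<in> V \<and> \<psi> (t + q, \<xi>) = G (\<phi> q))"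
      using U c
      by (intro exI[of _ UNIV] exI[of _ id] exI[of _ "UNIV \<times> U"] exI[of _ "map_prod id \<phi>"]
          exI[of _ "\<lambda>s. (t + s, \<phi> \<xi>)"]) (simp add: vec_atlas_def)
  qed
  then show ?thesis
    unfolding smooth_curve_at_def using e by auto
qed

text \<open>A deformation has a coordinate expression that uses any prescribed chart of the source and is smooth
  jointly in time and position.\<close>

lemma deformation_in_chart:
  fixes A :: "('a, 'b::real_normed_vector) atlas" and I :: "real set"
  assumes A: "smooth_atlas A"
    and \<mu>: "smooth_map (prod_atlas vec_atlas A) (I \<times> S) vec_atlas T (\<lambda>(t, \<xi>). \<mu> t \<xi>)"
    and "open I" "t \<in> I" "\<xi> \<in> S" and U: "(U, \<phi>) \<in> A" "\<xi> \<in> U"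
  obtains W G where "open W" "(t, \<phi> \<xi>) \<in> W" "smooth_on G W" "fst ` W \<subseteq> I"
    "\<forall>s. \<forall>q\<in>S \<inter> U. (s, \<phi> q) \<in> W \<longrightarrow> \<mu> s q = G (s, \<phi> q)"
proof -
  have prod: "smooth_atlas (prod_atlas (vec_atlas :: (real, real) atlas) A)"
    by (rule smooth_atlas_prod_atlas[OF smooth_atlas_vec_atlas A]) simp
  have c: "(UNIV \<times> U, map_prod id \<phi>) \<in> prod_atlas (vec_atlas :: (real, real) atlas) A"
    using U by (auto simp: prod_atlas_def vec_atlas_def)
  have p: "(t, \<xi>) \<in> I \<times> S" "(t, \<xi>) \<in> UNIV \<times> U"
    using assms by simp_all
  obtain W G where W: "open W" "map_prod id \<phi> (t, \<xi>) \<in> W" "smooth_on G W"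
    and G: "\<forall>q\<in>(I \<times> S) \<inter> (UNIV \<times> U). map_prod id \<phi> q \<in> W \<longrightarrow>
      (\<lambda>(t, \<xi>). \<mu> t \<xi>) q = G (map_prod id \<phi> q)"
    by (rule smooth_map_vec_in_chart[OF prod \<mu> p(1) c p(2)]) (rule that)
  show ?thesis
  proof (rule that[of "W \<inter> I \<times> UNIV" G])
    show "open (W \<inter> I \<times> UNIV)"
      using W \<open>open I\<close> by (intro open_Int open_Times) auto
    show "smooth_on G (W \<inter> I \<times> UNIV)"
      using W(3) by (rule smooth_on_subset) auto
    show "\<forall>s. \<forall>q\<in>S \<inter> U. (s, \<phi> q) \<in> W \<inter> I \<times> UNIV \<longrightarrow> \<mu> s q = G (s, \<phi> q)"
      using bspec[OF G, of "(s, q)" for s q] by auto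
  qed (use W assms in auto)
qed

lemma has_vector_derivative_time:
  assumes W: "open W" "(t, x) \<in> W" and G: "smooth_on G W"
    and eq: "\<And>s. (s, x) \<in> W \<Longrightarrow> m s = G (s, x)"
  shows "(m has_vector_derivative frechet_derivative G (at (t, x)) (1, 0)) (at t)"
proof -
  have d: "(G has_derivative frechet_derivative G (at (t, x))) (at (t, x))"
    by (rule smooth_on_has_derivative[OF G W])
  have s: "((\<lambda>s. (s, x)) has_vector_derivative (1, 0)) (at t)"
    by (auto intro!: derivative_eq_intros simp: has_vector_derivative_def)
  have "open ((\<lambda>s. (s, x)) -` W)"
    by (rule open_vimage[OF W(1)]) (intro continuous_intros)
  then show ?thesis
    by (rule has_vector_derivative_transform_within_open[OF
          vector_derivative_diff_chain_within[OF s has_derivative_at_withinI[OF d], unfolded o_def]])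
      (use W eq in auto)
qed

lemma has_vector_derivative_along_curve:
  assumes W: "open W" "(t, g 0) \<in> W" and G: "smooth_on G W"
    and R: "open R" "0 \<in> R" and g: "smooth_on g R" "(g has_vector_derivative w) (at 0)"
    and eq: "\<And>r. r \<in> R \<Longrightarrow> (t, g r) \<in> W \<Longrightarrow> m r = G (t, g r)"
  shows "(m has_vector_derivative frechet_derivative G (at (t, g 0)) (0, w)) (at 0)"
proof -
  have d: "(G has_derivative frechet_derivative G (at (t, g 0))) (at (t, g 0))"
    by (rule smooth_on_has_derivative[OF G W])
  have s: "((\<lambda>r. (t, g r)) has_vector_derivative (0, w)) (at 0)"
    using g(2) by (auto intro!: derivative_eq_intros simp: has_vector_derivative_def)
  have o: "open (R \<inter> (\<lambda>r. (t, g r)) -` W)"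
    using smooth_on_imp_continuous_on[OF g(1)]
    by (intro continuous_open_preimage[OF _ R(1) W(1)] continuous_intros)
  show ?thesis
    by (rule has_vector_derivative_transform_within_open[OF
          vector_derivative_diff_chain_within[OF s has_derivative_at_withinI[OF d], unfolded o_def] o])
      (use W R eq in auto)
qed

text \<open>The Hamiltonian is the contact form evaluated on the velocity of the lifted deformation. It is
  global, whereas charts are used only to see that it is smooth and to compute its differential.\<close>

lemma legendrian_deformation_hamiltonian:
  fixes A :: "('a, 'b::real_normed_vector) atlas"
    and \<mu> :: "real \<Rightarrow> 'a \<Rightarrow> 'e::euclidean_space \<times> 'e"
  assumes A: "smooth_atlas A" and cover: "S \<subseteq> \<Union>(fst ` A)" and "open I" "t \<in> I"
    and \<mu>: "smooth_map (prod_atlas vec_atlas A) (I \<times> S) vec_atlas unit_tangent_bundle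
      (\<lambda>(t, \<xi>). \<mu> t \<xi>)"
    and legendrian: "\<And>s \<xi> c Z. s \<in> I \<Longrightarrow> \<xi> \<in> S \<Longrightarrow> smooth_curve_at A S \<xi> c \<Longrightarrow>
      ((\<lambda>r. \<mu> s (c r)) has_vector_derivative Z) (at 0) \<Longrightarrow> contact_form (\<mu> s \<xi>) Z = 0"
  shows "exact_1form A S (deformation_1form (\<lambda>s \<xi>. piQ (\<mu> s \<xi>)) t)"
proof -
  define h where "h \<xi> = contact_form (\<mu> t \<xi>) (vector_derivative (\<lambda>s. \<mu> s \<xi>) (at t))" for \<xi>
  have fin: "finite_dimensional TYPE('b)"
    using A by (simp add: smooth_atlas_def)
  have prod: "smooth_atlas (prod_atlas (vec_atlas :: (real, real) atlas) A)"
    by (rule smooth_atlas_prod_atlas[OF smooth_atlas_vec_atlas A]) simp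
  have vec: "smooth_atlas (vec_atlas :: ('e \<times> 'e, 'e \<times> 'e) atlas)"
    by (rule smooth_atlas_vec_atlas) simp
  have \<mu>t: "smooth_map A S vec_atlas unit_tangent_bundle (\<mu> t)"
    using smooth_map_compose[OF prod smooth_map_Pair[OF cover \<open>t \<in> I\<close>] \<mu>] by (simp add: o_def)

  have h_local: "h q = contact_form (G (t, \<phi> q)) (frechet_derivative G (at (t, \<phi> q)) (1, 0))"
    if "open W" "smooth_on G W" "(t, \<phi> q) \<in> W" "q \<in> S \<inter> U"
      and G: "\<forall>s. \<forall>q\<in>S \<inter> U. (s, \<phi> q) \<in> W \<longrightarrow> \<mu> s q = G (s, \<phi> q)" for q U \<phi> W G
  proof -
    have "((\<lambda>s. \<mu> s q) has_vector_derivative frechet_derivative G (at (t, \<phi> q)) (1, 0)) (at t)"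
      using that by (intro has_vector_derivative_time[of W]) auto
    then show ?thesis
      using that by (simp add: h_def vector_derivative_at)
  qed

  have h_smooth: "h \<in> smooth_functions A S"
    unfolding smooth_functions_def
  proof (rule CollectI, rule smooth_map_vecI)
    fix p assume p: "p \<in> S"
    obtain U \<phi> where U: "(U, \<phi>) \<in> A" "p \<in> U"
      using chart_exists[OF subsetD[OF cover p]] by blast
    obtain W G where W: "open W" "(t, \<phi> p) \<in> W" and G: "smooth_on G W" and "fst ` W \<subseteq> I"
      and eq: "\<forall>s. \<forall>q\<in>S \<inter> U. (s, \<phi> q) \<in> W \<longrightarrow> \<mu> s q = G (s, \<phi> q)"
      by (rule deformation_in_chart[OF A \<mu> \<open>open I\<close> \<open>t \<in> I\<close> p U]) (rule that)
    let ?W = "{y. (t, y) \<in> W}"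
    let ?H = "\<lambda>y. contact_form (G (t, y)) (frechet_derivative G (at (t, y)) (1, 0))"
    have o: "open ?W"
      using open_vimage[OF W(1), of "Pair t"] by (simp add: vimage_def continuous_on_Pair)
    have pair: "smooth_on (Pair t) ?W"
      by (rule smooth_on_Pair[OF o smooth_on_const smooth_on_bounded_linear[OF o bounded_linear_ident]])
    have comp: "smooth_on (\<lambda>y. F (t, y)) ?W" if "smooth_on F W" for F :: "real \<times> 'b \<Rightarrow> 'e \<times> 'e"
      by (rule smooth_on_compose[OF _ o W(1) _ that pair]) (use fin in auto)
    have "smooth_on ?H ?W"
      unfolding contact_form_def
      by (rule smooth_on_bilinear[OF o bounded_bilinear_inner
            smooth_on_bounded_linear_compose[OF o bounded_linear_fst
              comp[OF smooth_on_directional_derivative[OF G]]]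
            smooth_on_bounded_linear_compose[OF o bounded_linear_snd comp[OF G]]])
    then show "\<exists>U \<phi> W G. (U, \<phi>) \<in> A \<and> p \<in> U \<and> open W \<and> \<phi> p \<in> W \<and> smooth_on G W \<and>
        (\<forall>q\<in>S \<inter> U. \<phi> q \<in> W \<longrightarrow> h q = G (\<phi> q))"
      using U W o h_local[OF W(1) G _ _ eq]
      by (intro exI[of _ U] exI[of _ \<phi>] exI[of _ ?W] exI[of _ ?H]) auto
  qed simp

  have "deformation_1form (\<lambda>s \<xi>. piQ (\<mu> s \<xi>)) t \<xi> Z = Z h"
    if \<xi>: "\<xi> \<in> S" and Z: "Z \<in> tangent_space A S \<xi>" for \<xi> Z
  proof -
    obtain c where c: "smooth_curve_at A S \<xi> c" and Z: "Z = velocity (smooth_functions A S) c 0"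
      using Z unfolding tangent_space_def by blast
    have c0: "c 0 = \<xi>"
      using c by (simp add: smooth_curve_at_def)
    obtain U \<phi> R g where U: "(U, \<phi>) \<in> A" "\<xi> \<in> U" and R: "open R" "0 \<in> R" "smooth_on g R"
      and g: "\<forall>r\<in>R. c r \<in> S \<and> c r \<in> U \<and> \<phi> (c r) = g r"
      by (rule smooth_curve_in_chart[OF c]) (rule that)
    have g0: "g 0 = \<phi> \<xi>"
      using g R c0 by metis
    define w where "w = vector_derivative g (at 0)"
    have w: "(g has_vector_derivative w) (at 0)"
      using smooth_on_has_derivative[OF R(3,1,2)] unfolding w_def
      by (simp add: differentiableI flip: vector_derivative_works)
    obtain W G where W: "open W" "(t, \<phi> \<xi>) \<in> W" and G: "smooth_on G W" and I: "fst ` W \<subseteq> I"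
      and eq: "\<forall>s. \<forall>q\<in>S \<inter> U. (s, \<phi> q) \<in> W \<longrightarrow> \<mu> s q = G (s, \<phi> q)"
      by (rule deformation_in_chart[OF A \<mu> \<open>open I\<close> \<open>t \<in> I\<close> \<xi> U]) (rule that)
    let ?G' = "\<lambda>z. frechet_derivative G (at z)"
    have along: "((\<lambda>r. \<mu> s (c r)) has_vector_derivative ?G' (s, \<phi> \<xi>) (0, w)) (at 0)"
      if "(s, \<phi> \<xi>) \<in> W" for s
      using has_vector_derivative_along_curve[OF W(1) _ G R(1,2,3) w, of s "\<lambda>r. \<mu> s (c r)"] that g eq
      by (simp add: g0)
    have "contact_form (G (s, \<phi> \<xi>)) (?G' (s, \<phi> \<xi>) (0, w)) = 0" if "(s, \<phi> \<xi>) \<in> W" for s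
    proof -
      have "s \<in> I"
        using I that by force
      then have "contact_form (\<mu> s \<xi>) (?G' (s, \<phi> \<xi>) (0, w)) = 0"
        by (rule legendrian[OF _ \<xi> c along[OF that]])
      then show ?thesis
        using eq \<xi> U that by simp
    qed
    from contact_potential_derivative[OF W G this] obtain D where
      D: "((\<lambda>x. contact_form (G (t, x)) (?G' (t, x) (1, 0))) has_derivative D) (at (\<phi> \<xi>))"
      and Dw: "D w = - ext_deriv contact_form (G (t, \<phi> \<xi>)) (?G' (t, \<phi> \<xi>) (1, 0)) (?G' (t, \<phi> \<xi>) (0, w))"
      by blast

    have "((\<lambda>r. h (c r)) has_vector_derivative D w) (at 0)"
    proof (rule has_vector_derivative_transform_within_open)
      show "((\<lambda>r. contact_form (G (t, g r)) (?G' (t, g r) (1, 0))) has_vector_derivative D w) (at 0)"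
        using vector_derivative_diff_chain_within[OF w has_derivative_at_withinI[OF D[folded g0]]]
        by (simp add: o_def)
      show "open (R \<inter> (\<lambda>r. (t, g r)) -` W)"
        using smooth_on_imp_continuous_on[OF R(3)]
        by (intro continuous_open_preimage[OF _ R(1) W(1)] continuous_intros)
      show "0 \<in> R \<inter> (\<lambda>r. (t, g r)) -` W"
        using R W g0 by simp
      show "contact_form (G (t, g r)) (?G' (t, g r) (1, 0)) = h (c r)"
        if "r \<in> R \<inter> (\<lambda>r. (t, g r)) -` W" for r
        using h_local[OF W(1) G _ _ eq, of "c r"] that g by simp
    qed
    then have Zh: "Z h = D w"
      using h_smooth
      by (simp add: Z velocity_def has_real_derivative_iff_has_vector_derivative DERIV_imp_deriv)

    \<comment> \<open>Lifts of the two tangent vectors to the unit tangent bundle, both through \<open>\<mu> t \<xi>\<close>.\<close>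
    have a: "smooth_curve_at vec_atlas unit_tangent_bundle (\<mu> t \<xi>) (\<lambda>s. \<mu> (t + s) \<xi>)"
      using smooth_curve_compose[OF prod smooth_curve_time[OF cover \<open>open I\<close> \<open>t \<in> I\<close> \<xi>] \<mu>]
      by (simp add: o_def)
    have b: "smooth_curve_at vec_atlas unit_tangent_bundle (\<mu> t \<xi>) (\<mu> t \<circ> c)"
      by (rule smooth_curve_compose[OF A c \<mu>t])
    have shift: "((\<lambda>s. t + s) has_vector_derivative 1) (at 0)"
      by (auto intro!: derivative_eq_intros)
    have "((\<lambda>s. \<mu> s \<xi>) has_vector_derivative ?G' (t, \<phi> \<xi>) (1, 0)) (at t)"
      using \<xi> U eq by (intro has_vector_derivative_time[OF W G]) simp
    then have "((\<lambda>s. \<mu> (t + s) \<xi>) has_vector_derivative ?G' (t, \<phi> \<xi>) (1, 0)) (at 0)"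
      using vector_diff_chain_at[OF shift, of "\<lambda>s. \<mu> s \<xi>"] by (simp add: o_def)
    then have a': "vector_derivative (\<lambda>s. \<mu> (t + s) \<xi>) (at 0) = ?G' (t, \<phi> \<xi>) (1, 0)"
      by (rule vector_derivative_at)
    have b': "vector_derivative (\<mu> t \<circ> c) (at 0) = ?G' (t, \<phi> \<xi>) (0, w)"
      using along[OF W(2)] by (simp add: o_def vector_derivative_at)
    have V: "velocity smooth_functions_Q (\<lambda>s. piQ (\<mu> s \<xi>)) t
        = velocity smooth_functions_Q (piQ \<circ> (\<lambda>s. \<mu> (t + s) \<xi>)) 0"
      unfolding velocity_def by (intro restrict_ext) (simp add: deriv_shift_0' o_def)
    have "u \<circ> (\<lambda>\<xi>. piQ (\<mu> t \<xi>)) \<in> smooth_functions A S" if "u \<in> smooth_functions_Q" for u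
    proof -
      have "smooth_map vec_atlas unit_tangent_bundle vec_atlas UNIV (u \<circ> piQ)"
        using that by (simp add: smooth_functions_Q_def smooth_functions_def)
      from smooth_map_compose[OF vec \<mu>t this] show ?thesis
        by (simp add: smooth_functions_def o_def)
    qed
    then have W: "differential smooth_functions_Q (\<lambda>\<xi>. piQ (\<mu> t \<xi>)) Z
        = velocity smooth_functions_Q (piQ \<circ> (\<mu> t \<circ> c)) 0"
      unfolding differential_def velocity_def Z by (intro restrict_ext) (simp add: o_def)
    have "\<mu> t \<xi> \<in> unit_tangent_bundle"
      by (rule smooth_mapD[OF \<mu>t \<xi>])
    from lambda_Q_velocities[OF this a b] have "deformation_1form (\<lambda>s \<xi>. piQ (\<mu> s \<xi>)) t \<xi> Z
        = - ext_deriv contact_form (\<mu> t \<xi>) (?G' (t, \<phi> \<xi>) (1, 0)) (?G' (t, \<phi> \<xi>) (0, w))"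
      unfolding deformation_1form_def V W a' b' .
    also have "\<dots> = D w"
      using Dw eq \<xi> U \<open>(t, \<phi> \<xi>) \<in> W\<close> by simp
    finally show ?thesis
      using Zh by simp
  qed
  with h_smooth show ?thesis
    unfolding exact_1form_def by blast
qed

section \<open>Gauss maps are Legendrian\<close>

lemma smooth_map_fst:
  fixes A :: "('a, 'b::real_normed_vector) atlas"
  assumes cover: "M \<subseteq> \<Union>(fst ` A)" and S: "fst ` S \<subseteq> M"
  shows "smooth_map (prod_atlas A (vec_atlas :: ('e::real_normed_vector, 'e) atlas)) S A M fst"
proof (rule smooth_mapI)
  fix p assume p: "p \<in> S"
  then show "fst p \<in> M"
    using S by blast
  then obtain U \<phi> where U: "(U, \<phi>) \<in> A" "fst p \<in> U"
    using chart_exists[OF subsetD[OF cover]] by blast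
  have c: "(U \<times> UNIV, map_prod \<phi> id) \<in> prod_atlas A (vec_atlas :: ('e, 'e) atlas)"
    using U by (auto simp: prod_atlas_def vec_atlas_def)
  have "smooth_on fst (UNIV :: ('b \<times> 'e) set)"
    by (rule smooth_on_bounded_linear[OF open_UNIV bounded_linear_fst])
  then show "\<exists>U \<phi> V \<psi> W G. (U, \<phi>) \<in> prod_atlas A (vec_atlas :: ('e, 'e) atlas) \<and> (V, \<psi>) \<in> A \<and>
      p \<in> U \<and> fst p \<in> V \<and> open W \<and> \<phi> p \<in> W \<and> smooth_on G W \<and>
      (\<forall>q\<in>S \<inter> U. \<phi> q \<in> W \<longrightarrow> fst q \<in> V \<and> \<psi> (fst q) = G (\<phi> q))"
    using U c
    by (intro exI[of _ "U \<times> UNIV"] exI[of _ "map_prod \<phi> id"] exI[of _ U] exI[of _ \<phi>]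
        exI[of _ UNIV] exI[of _ fst]) (auto simp: mem_Times_iff)
qed

text \<open>\<open>normal_space\<close> speaks about the derivative of \<open>f\<close> in charts, whose directions include the coordinate
  velocities of all curves.\<close>

lemma normal_space_orthogonal:
  fixes A :: "('a, 'b::real_normed_vector) atlas" and f :: "'a \<Rightarrow> 'e::euclidean_space"
  assumes A: "smooth_atlas A" and charts: "\<And>U \<phi>. (U, \<phi>) \<in> A \<Longrightarrow> U \<subseteq> M"
    and f: "smooth_map A M vec_atlas T f" and c: "smooth_curve_at A M p c"
    and v: "((\<lambda>r. f (c r)) has_vector_derivative v) (at 0)" and \<nu>: "\<nu> \<in> normal_space A f p"
  shows "v \<bullet> \<nu> = 0"
proof -
  obtain U \<phi> R g where U: "(U, \<phi>) \<in> A" "p \<in> U" and R: "open R" "0 \<in> R" "smooth_on g R"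
    and g: "\<forall>r\<in>R. c r \<in> M \<and> c r \<in> U \<and> \<phi> (c r) = g r"
    by (rule smooth_curve_in_chart[OF c]) (rule that)
  have g0: "g 0 = \<phi> p"
    using g R c by (metis smooth_curve_at_def)
  have p: "p \<in> M"
    using charts U by blast
  obtain W G where W: "open W" "\<phi> p \<in> W" "smooth_on G W"
    and G: "\<forall>q\<in>M \<inter> U. \<phi> q \<in> W \<longrightarrow> f q = G (\<phi> q)"
    by (rule smooth_map_vec_in_chart[OF A f p U]) (rule that)
  note D = smooth_on_has_derivative[OF W(3,1,2)]
  have "((f \<circ> inv_into U \<phi>) has_derivative frechet_derivative G (at (\<phi> p))) (at (\<phi> p))"
  proof (rule has_derivative_transform_within_open[OF D])
    show "open (W \<inter> \<phi> ` U)"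
      using smooth_atlasD(3)[OF A U(1) U(1)] W by (simp add: open_Int)
    show "G y = (f \<circ> inv_into U \<phi>) y" if y: "y \<in> W \<inter> \<phi> ` U" for y
    proof -
      obtain q where "q \<in> U" "y = \<phi> q"
        using y by blast
      then show ?thesis
        using G y charts[OF U(1)] smooth_atlasD(2)[OF A U(1) U(1)] by auto
    qed
  qed (use W U in simp)
  then have "frechet_derivative (f \<circ> inv_into U \<phi>) (at (\<phi> p)) = frechet_derivative G (at (\<phi> p))"
    by (rule frechet_derivative_at[symmetric])
  then have orth: "\<nu> \<bullet> frechet_derivative G (at (\<phi> p)) w = 0" for w
    using \<nu> U unfolding normal_space_def by auto
  define w where "w = vector_derivative g (at 0)"
  have w: "(g has_vector_derivative w) (at 0)"
    using smooth_on_has_derivative[OF R(3,1,2)] unfolding w_def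
    by (simp add: differentiableI flip: vector_derivative_works)
  have o: "open (R \<inter> g -` W)"
    by (rule continuous_open_preimage[OF smooth_on_imp_continuous_on[OF R(3)] R(1) W(1)])
  have "((\<lambda>r. G (g r)) has_vector_derivative frechet_derivative G (at (\<phi> p)) w) (at 0)"
    using vector_derivative_diff_chain_within[OF w has_derivative_at_withinI[OF D[folded g0]]]
    by (simp add: o_def g0)
  then have "((\<lambda>r. f (c r)) has_vector_derivative frechet_derivative G (at (\<phi> p)) w) (at 0)"
    by (rule has_vector_derivative_transform_within_open[OF _ o]) (use R W g g0 G in auto)
  then have "v = frechet_derivative G (at (\<phi> p)) w"
    using v vector_derivative_unique_at by blast
  then show ?thesis
    using orth by (simp add: inner_commute)
qed

theorem proposition4p1:
  fixes X :: "'a topology"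
    and A :: "('a, 'b::real_normed_vector) atlas"
    and I :: "real set"
    and f :: "real \<Rightarrow> 'a \<Rightarrow> 'e::euclidean_space"
    and \<mu> :: "real \<Rightarrow> 'a \<times> 'e \<Rightarrow> 'e \<times> 'e"
    and \<gamma> :: "real \<Rightarrow> 'a \<times> 'e \<Rightarrow> ('e \<times> 'e) set"
  defines "M \<equiv> topspace X"
  assumes "smooth_manifold X A" and "compact_space X" and "oriented_atlas A"
    and "open I" and "is_interval I" and "0 \<in> I"
    and "smooth_map (prod_atlas vec_atlas A) (I \<times> M) vec_atlas (sphere 0 1) (\<lambda>(t, p). f t p)"
    and "\<And>t. t \<in> I \<Longrightarrow> immersion A M (f t)"
    and "\<And>t. t \<in> I \<Longrightarrow>
           diffeomorphic (prod_atlas A vec_atlas) (normal_bundle A M (f t))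
             (prod_atlas A vec_atlas) (normal_bundle A M (f 0))"
    and "compatible_deformation A M I f \<mu>"
    and "\<And>t \<xi>. \<gamma> t \<xi> = piQ (\<mu> t \<xi>)"
  shows "\<forall>t\<in>I. exact_1form (prod_atlas A vec_atlas) (unit_normal_bundle A M (f 0))
                 (deformation_1form \<gamma> t)"
proof
  fix t assume t: "t \<in> I"
  let ?A = "prod_atlas A (vec_atlas :: ('e, 'e) atlas)" and ?S = "unit_normal_bundle A M (f 0)"
  have A: "smooth_atlas A"
    by (rule smooth_manifold_imp_smooth_atlas) fact
  have A': "smooth_atlas ?A"
    by (rule smooth_atlas_prod_atlas[OF A smooth_atlas_vec_atlas]) simp
  have cover: "\<Union>(fst ` A) = M"
    using \<open>smooth_manifold X A\<close> unfolding smooth_manifold_def M_def by blast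
  have S: "fst ` ?S \<subseteq> M"
    by (auto simp: unit_normal_bundle_def normal_bundle_def)
  have fst: "smooth_map ?A ?S A M fst"
    by (rule smooth_map_fst[OF _ S]) (simp add: cover)
  have "?S \<subseteq> \<Union>(fst ` ?A)"
  proof
    fix \<xi> assume "\<xi> \<in> ?S"
    then obtain U \<phi> where "(U, \<phi>) \<in> A" "fst \<xi> \<in> U"
      using chart_exists[of "fst \<xi>" A] S cover by blast
    then have "(U \<times> UNIV, map_prod \<phi> id) \<in> ?A" "\<xi> \<in> U \<times> UNIV"
      by (auto simp: prod_atlas_def vec_atlas_def mem_Times_iff)
    then show "\<xi> \<in> \<Union>(fst ` ?A)"
      by force
  qed
  moreover have "smooth_map (prod_atlas vec_atlas ?A) (I \<times> ?S) vec_atlas unit_tangent_bundle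
      (\<lambda>(t, \<xi>). \<mu> t \<xi>)"
    using \<open>compatible_deformation A M I f \<mu>\<close> unfolding compatible_deformation_def by blast
  moreover have "contact_form (\<mu> s \<xi>) Z = 0"
    if s: "s \<in> I" and \<xi>: "\<xi> \<in> ?S" and c: "smooth_curve_at ?A ?S \<xi> c"
      and Z: "((\<lambda>r. \<mu> s (c r)) has_vector_derivative Z) (at 0)" for s \<xi> c Z
  proof -
    obtain \<Phi> where iso: "bundle_isomorphism A ?S (unit_normal_bundle A M (f s)) \<Phi>"
      and \<Phi>: "\<mu> s \<xi> = spherical_gauss_map (f s) (\<Phi> \<xi>)"
      using \<open>compatible_deformation A M I f \<mu>\<close> s \<xi> unfolding compatible_deformation_def by blast
    have "fst (\<Phi> \<xi>) = fst \<xi>"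
      using iso \<xi> unfolding bundle_isomorphism_def by blast
    moreover have "\<Phi> \<xi> \<in> unit_normal_bundle A M (f s)"
      using iso \<xi> unfolding bundle_isomorphism_def by (blast dest: smooth_mapD)
    \<comment> \<open>The isomorphism \<open>\<Phi>\<close> covers the identity, so \<open>\<mu> s \<xi>\<close> is a unit normal vector at the same base point.\<close>
    ultimately have \<nu>: "snd (\<mu> s \<xi>) \<in> normal_space A (f s) (fst \<xi>)"
      by (auto simp: \<Phi> spherical_gauss_map_def unit_normal_bundle_def normal_bundle_def)
    have fs: "smooth_map A M vec_atlas (sphere 0 1) (f s)"
      using \<open>s \<in> I \<Longrightarrow> immersion A M (f s)\<close> s unfolding immersion_def by blast
    have base: "smooth_curve_at A M (fst \<xi>) (fst \<circ> c)"
      by (rule smooth_curve_compose[OF A' c fst])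
    obtain e where e: "e > 0" and ce: "\<And>r. r \<in> {-e<..<e} \<Longrightarrow> c r \<in> ?S"
      using c unfolding smooth_curve_at_def by (blast dest: smooth_mapD)
    have fst_\<mu>: "fst (\<mu> s \<eta>) = f s (fst \<eta>)" if "\<eta> \<in> ?S" for \<eta>
      using \<open>compatible_deformation A M I f \<mu>\<close> s that unfolding compatible_deformation_def by blast
    have "((\<lambda>r. fst (\<mu> s (c r))) has_vector_derivative fst Z) (at 0)"
      by (rule bounded_linear.has_vector_derivative[OF bounded_linear_fst Z])
    then have "((\<lambda>r. f s ((fst \<circ> c) r)) has_vector_derivative fst Z) (at 0)"
      by (rule has_vector_derivative_transform_within_open[where S = "{-e<..<e}"])
        (use e ce fst_\<mu> in auto)
    then have "fst Z \<bullet> snd (\<mu> s \<xi>) = 0"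
      using cover by (intro normal_space_orthogonal[OF A _ fs base _ \<nu>]) force
    then show ?thesis
      by (simp add: contact_form_def)
  qed
  ultimately have "exact_1form ?A ?S (deformation_1form (\<lambda>s \<xi>. piQ (\<mu> s \<xi>)) t)"
    using \<open>open I\<close> t by (intro legendrian_deformation_hamiltonian[OF A']) auto
  moreover have "\<gamma> = (\<lambda>s \<xi>. piQ (\<mu> s \<xi>))"
    using assms by (simp add: fun_eq_iff)
  ultimately show "exact_1form ?A ?S (deformation_1form \<gamma> t)"
    by simp
qed

end
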